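(* If $\gamma>0$, then for any real constants $a=(a_e)_{e\in E}$ the random field $W(\sigma)=\sum_{e\in E}a_eg_ef_e(\sigma)$ satisfies $$\mathbb{E}\bigl(\langle W(\sigma)^2\rangle-\langle W(\sigma)\rangle^2\bigr)\leq\|a\|_2^2+\sqrt{2}\,\|a\|_2\|a\|_1.$$
   Context: Let $(\Sigma,\mathcal{F})$ be a measurable space, $E$ a fixed finite index set, $(f_e)_{e\in E}$ a family of measurable functions $f_e:\Sigma\to[-1,1]$, and $(g_e)_{e\in E}$ i.i.d. standard Gaussian random variables. Let $$Y(\sigma)=\sum_{e\in E}g_ef_e(\sigma),\qquad dG(\sigma)=\frac{\exp(\gamma Y(\sigma))}{Z}\,d\mu(\sigma),$$ where $\gamma>0$ is a constant, $\mu$ is a (possibly random) finite nonzero measure on $(\Sigma,\mathcal{F})$, and $Z$ is the normalizing constant making the Gibbs measure $G$ a probability measure. The functions $f_e$ may also be random; all the randomness of $(f_e)_{e\in E}$ and $\mu$ is independent of $(g_e)_{e\in E}$. The bracket $\langle\,\cdot\,\rangle$ denotes the average with respect to $G$ (for fixed disorder, including the $g_e$), and $\mathbb{E}$ the expectation over all the disorder. Notation: $\|a\|_2=(\sum_{e\in E}a_e^2)^{1/2}$ and $\|a\|_1=\sum_{e\in E}|a_e|$. *)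

theory Defs
  imports "HOL-Probability.Probability"
begin

text \<open>A random finite measure on \<open>(space S, sets S)\<close>, measurable with respect to the
  \<open>\<sigma>\<close>-algebra of \<open>H\<close>. Only the measurable-space parts of \<open>H\<close> and \<open>S\<close> matter.\<close>

definition random_finite_measure ::
    "'w measure \<Rightarrow> 's measure \<Rightarrow> ('w \<Rightarrow> 's measure) \<Rightarrow> bool" where
  "random_finite_measure H S \<mu> \<longleftrightarrow>
     (\<forall>\<omega>\<in>space H. sets (\<mu> \<omega>) = sets S \<and> finite_measure (\<mu> \<omega>)) \<and>
     (\<forall>A\<in>sets S. (\<lambda>\<omega>. emeasure (\<mu> \<omega>) A) \<in> borel_measurable H)"

definition field_Y :: "'e set \<Rightarrow> ('e \<Rightarrow> real) \<Rightarrow> ('e \<Rightarrow> 's \<Rightarrow> real) \<Rightarrow> 's \<Rightarrow> real" where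
  "field_Y E g f \<sigma> = (\<Sum>e\<in>E. g e * f e \<sigma>)"

definition field_W ::
    "'e set \<Rightarrow> ('e \<Rightarrow> real) \<Rightarrow> ('e \<Rightarrow> real) \<Rightarrow> ('e \<Rightarrow> 's \<Rightarrow> real) \<Rightarrow> 's \<Rightarrow> real" where
  "field_W E a g f \<sigma> = (\<Sum>e\<in>E. a e * g e * f e \<sigma>)"

definition partition_function :: "real \<Rightarrow> ('s \<Rightarrow> real) \<Rightarrow> 's measure \<Rightarrow> real" where
  "partition_function \<gamma> Y \<mu> = (\<integral>\<sigma>. exp (\<gamma> * Y \<sigma>) \<partial>\<mu>)"

definition gibbs_measure :: "real \<Rightarrow> ('s \<Rightarrow> real) \<Rightarrow> 's measure \<Rightarrow> 's measure" where
  "gibbs_measure \<gamma> Y \<mu> =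
     density \<mu> (\<lambda>\<sigma>. ennreal (exp (\<gamma> * Y \<sigma>) / partition_function \<gamma> Y \<mu>))"

text \<open>\<open>\<langle>W\<^sup>2\<rangle> - \<langle>W\<rangle>\<^sup>2\<close>, the brackets being averages with respect to the Gibbs measure
  for a fixed realization \<open>g\<close>, \<open>f\<close>, \<open>\<mu>\<close> of the disorder.\<close>

definition gibbs_fluctuation ::
    "'e set \<Rightarrow> real \<Rightarrow> ('e \<Rightarrow> real) \<Rightarrow> ('e \<Rightarrow> real) \<Rightarrow> ('e \<Rightarrow> 's \<Rightarrow> real) \<Rightarrow> 's measure \<Rightarrow> real" where
  "gibbs_fluctuation E \<gamma> a g f \<mu> =
     (let G = gibbs_measure \<gamma> (field_Y E g f) \<mu> in
       (\<integral>\<sigma>. (field_W E a g f \<sigma>)\<^sup>2 \<partial>G) - (\<integral>\<sigma>. field_W E a g f \<sigma> \<partial>G)\<^sup>2)"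

end

theory Submission
  imports Defs "HOL-Real_Asymp.Real_Asymp"
begin

text \<open>
  For fixed \<open>f\<close> and \<open>\<mu>\<close> the fluctuation is \<open>\<Sum>d,e. a\<^sub>d a\<^sub>e g\<^sub>d g\<^sub>e C(d,e)\<close>, where \<open>C(d,e)\<close>
  is the Gibbs covariance of \<open>f\<^sub>d\<close> and \<open>f\<^sub>e\<close>. Differentiating \<open>C(d,e)\<close> in \<open>g\<^sub>i\<close> gives \<open>\<gamma>\<close> times
  the joint cumulant of \<open>f\<^sub>d, f\<^sub>e, f\<^sub>i\<close>, which is symmetric. So for \<open>d \<noteq> e\<close>, Gaussian integration by
  parts in \<open>g\<^sub>d\<close>, followed by the reverse one in \<open>g\<^sub>e\<close>, gives
  \<open>E g\<^sub>d g\<^sub>e C(d,e) = \<gamma> E g\<^sub>e \<kappa>(d,e,d) = E (g\<^sub>e\<^sup>2 - 1) C(d,d)\<close>, and \<open>\<gamma>\<close> disappears. Hence the expected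
  fluctuation equals \<open>\<Sum>d. a\<^sub>d\<^sup>2 E C(d,d) + \<Sum>d. a\<^sub>d E (C(d,d) X)\<close> with \<open>X = \<Sum>e. a\<^sub>e (g\<^sub>e\<^sup>2 - 1)\<close>.
  Now \<open>\<bar>C(d,d)\<bar> \<le> 1\<close> and \<open>E \<bar>X\<bar> \<le> sqrt (E X\<^sup>2) = sqrt 2 \<parallel>a\<parallel>\<^sub>2\<close>. Fubini's theorem removes the assumption
  that \<open>f\<close> and \<open>\<mu>\<close> are fixed.
\<close>

section \<open>Gaussian integration by parts\<close>

abbreviation std_gaussian :: "real measure" where
  "std_gaussian \<equiv> density lborel (\<lambda>x. ennreal (std_normal_density x))"

abbreviation gaussian_PiM :: "'e set \<Rightarrow> ('e \<Rightarrow> real) measure" where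
  "gaussian_PiM E \<equiv> \<Pi>\<^sub>M e\<in>E. std_gaussian"

lemma prob_space_std_gaussian: "prob_space std_gaussian"
  by (rule prob_space_normal_density) simp

text \<open>The two sides are kept under one integral: where it is not integrable its junk value 0 is
  what the equation asserts, so that the lemma applies to every slice of a function integrable on
  the product space, and not just to almost every slice.\<close>

lemma std_gaussian_ibp:
  fixes F F' :: "real \<Rightarrow> real"
  assumes deriv: "\<And>t. (F has_real_derivative F' t) (at t)"
    and cont: "\<And>t. isCont F' t"
    and growth: "\<And>t. \<bar>F t\<bar> \<le> K * (1 + \<bar>t\<bar>)"
  shows "(\<integral>t. t * F t - F' t \<partial>std_gaussian) = 0"
proof (cases "integrable std_gaussian (\<lambda>t. t * F t - F' t)")
  case False
  then show ?thesis by (rule not_integrable_integral_eq)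
next
  case True
  let ?\<phi> = std_normal_density
  have contF: "isCont F t" for t
    using deriv by (rule DERIV_isCont)
  have meas: "(\<lambda>t. t * F t - F' t) \<in> borel_measurable borel"
    using contF cont by (intro borel_measurable_continuous_onI continuous_at_imp_continuous_on ballI continuous_intros) auto
  have \<phi>: "(?\<phi> has_real_derivative - t * ?\<phi> t) (at t)" for t
    unfolding std_normal_density_def[abs_def]
    by (auto intro!: derivative_eq_intros simp: field_simps)
  \<comment> \<open>The Gaussian density beats the linear growth of \<open>F\<close>, so the
    boundary terms at both ends vanish.\<close>
  have lim: "((\<lambda>t. - ?\<phi> t * F t) \<longlongrightarrow> 0) at_infinity"
  proof (rule Lim_null_comparison)
    show "\<forall>\<^sub>F t in at_infinity. norm (- ?\<phi> t * F t) \<le> ?\<phi> t * (K * (1 + \<bar>t\<bar>))"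
      using growth by (intro always_eventually allI) (auto simp: abs_mult intro!: mult_left_mono)
    show "((\<lambda>t. ?\<phi> t * (K * (1 + \<bar>t\<bar>))) \<longlongrightarrow> 0) at_infinity"
      unfolding at_infinity_eq_at_top_bot std_normal_density_def
      by (intro filterlim_sup; real_asymp)
  qed
  have "(\<integral>t. t * F t - F' t \<partial>std_gaussian) = (\<integral>t. ?\<phi> t * (t * F t - F' t) \<partial>lborel)"
    using meas by (subst integral_density) auto
  also have "\<dots> = (LBINT t=-\<infinity>..\<infinity>. ?\<phi> t * (t * F t - F' t))"
    by (simp add: interval_lebesgue_integral_def set_lebesgue_integral_def)
  also have "\<dots> = 0 - 0"
  proof (rule interval_integral_FTC_integrable)
    \<comment> \<open>The integrand has the explicit antiderivative
      \<open>- ?\<phi> t * F t\<close>, because the density satisfies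
      \<open>\<phi>' = - t \<phi>\<close>.\<close>
    show "((\<lambda>t. - ?\<phi> t * F t) has_vector_derivative ?\<phi> t * (t * F t - F' t)) (at t)" for t
      unfolding has_real_derivative_iff_has_vector_derivative[symmetric]
      by (rule DERIV_cong[OF DERIV_mult[OF DERIV_minus[OF \<phi>] deriv]]) (simp add: algebra_simps)
    show "isCont (\<lambda>t. ?\<phi> t * (t * F t - F' t)) t" for t
      using DERIV_isCont[OF \<phi>] contF cont by (intro continuous_intros)
    show "set_integrable lborel (einterval (-\<infinity>) \<infinity>) (\<lambda>t. ?\<phi> t * (t * F t - F' t))"
      using True meas by (subst (asm) integrable_density) (auto simp: set_integrable_def)
    show "(((\<lambda>t. - ?\<phi> t * F t) \<circ> real_of_ereal) \<longlongrightarrow> 0) (at_right (-\<infinity>))"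
      unfolding ereal_tendsto_simps by (rule tendsto_mono[OF _ lim]) (simp add: at_infinity_eq_at_top_bot)
    show "(((\<lambda>t. - ?\<phi> t * F t) \<circ> real_of_ereal) \<longlongrightarrow> 0) (at_left \<infinity>)"
      unfolding ereal_tendsto_simps by (rule tendsto_mono[OF _ lim]) (simp add: at_infinity_eq_at_top_bot)
  qed simp
  finally show ?thesis by simp
qed

lemma PiM_gaussian_ibp:
  fixes F F' :: "('e \<Rightarrow> real) \<Rightarrow> real"
  assumes E: "finite E" "e \<in> E"
    and deriv: "\<And>x t. ((\<lambda>t. F (x(e := t))) has_real_derivative F' (x(e := t))) (at t)"
    and cont: "\<And>x t. isCont (\<lambda>t. F' (x(e := t))) t"
    and growth: "\<And>x. \<exists>K. \<forall>t. \<bar>F (x(e := t))\<bar> \<le> K * (1 + \<bar>t\<bar>)"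
    and int: "integrable (gaussian_PiM E) (\<lambda>x. x e * F x)"
    and int': "integrable (gaussian_PiM E) F'"
  shows "(\<integral>x. x e * F x \<partial>gaussian_PiM E) = (\<integral>x. F' x \<partial>gaussian_PiM E)"
proof -
  interpret product_prob_space "\<lambda>_::'e. std_gaussian"
    by (intro product_prob_spaceI prob_space_std_gaussian)
  have ins: "insert e (E - {e}) = E" using E by auto
  have "(\<integral>x. x e * F x \<partial>gaussian_PiM E) - (\<integral>x. F' x \<partial>gaussian_PiM E) =
      (\<integral>x. x e * F x - F' x \<partial>gaussian_PiM (insert e (E - {e})))"
    unfolding ins using int int' by simp
  also have "\<dots> = (\<integral>x. (\<integral>t. t * F (x(e := t)) - F' (x(e := t)) \<partial>std_gaussian) \<partial>gaussian_PiM (E - {e}))"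
    using E int int' by (subst product_integral_insert) (auto simp: insert_absorb)
  also have "(\<lambda>x. \<integral>t. t * F (x(e := t)) - F' (x(e := t)) \<partial>std_gaussian) = (\<lambda>_. 0)"
  proof
    fix x
    obtain K where "\<And>t. \<bar>F (x(e := t))\<bar> \<le> K * (1 + \<bar>t\<bar>)"
      using growth by metis
    then show "(\<integral>t. t * F (x(e := t)) - F' (x(e := t)) \<partial>std_gaussian) = 0"
      by (rule std_gaussian_ibp[OF deriv cont])
  qed
  finally show ?thesis by simp
qed

section \<open>Moments and integrability under the Gaussian product measure\<close>

lemma integrable_PiM_gaussian_abs_power:
  assumes "e \<in> E"
  shows "integrable (gaussian_PiM E) (\<lambda>x. \<bar>x e\<bar> ^ n)"
proof -
  have "integrable std_gaussian (\<lambda>t. \<bar>t\<bar> ^ n)"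
    using integrable_std_normal_moment_abs by (subst integrable_density) auto
  then have "integrable (distr (gaussian_PiM E) std_gaussian (\<lambda>x. x e)) (\<lambda>t. \<bar>t\<bar> ^ n)"
    using assms by (subst distr_PiM_component) (auto simp: prob_space_std_gaussian)
  then show ?thesis
    using assms by (subst (asm) integrable_distr_eq) auto
qed

lemma integrable_PiM_gaussian_power:
  "e \<in> E \<Longrightarrow> integrable (gaussian_PiM E) (\<lambda>x. (x e) ^ n)"
  by (rule Bochner_Integration.integrable_bound[OF integrable_PiM_gaussian_abs_power[of e E n]])
     (auto simp: power_abs)

text \<open>Quadratic growth suffices for the Gibbs quantities integrated later: they are bounded
  functions times polynomials of degree at most two.\<close>

lemma integrable_PiM_gaussian_bound:
  fixes F :: "('e \<Rightarrow> real) \<Rightarrow> real"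
  assumes "finite E" "F \<in> borel_measurable (\<Pi>\<^sub>M e\<in>E. borel)"
    and "\<And>x. \<bar>F x\<bar> \<le> K * (1 + (\<Sum>e\<in>E. (x e)\<^sup>2))"
  shows "integrable (gaussian_PiM E) F"
proof (rule Bochner_Integration.integrable_bound)
  interpret P: prob_space "gaussian_PiM E"
    by (intro prob_space_PiM prob_space_std_gaussian)
  show "integrable (gaussian_PiM E) (\<lambda>x. K * (1 + (\<Sum>e\<in>E. (x e)\<^sup>2)))"
    by (intro integrable_mult_right Bochner_Integration.integrable_add P.integrable_const
        Bochner_Integration.integrable_sum integrable_PiM_gaussian_power)
  have "sets (gaussian_PiM E) = sets (\<Pi>\<^sub>M e\<in>E. borel)"
    by (intro sets_PiM_cong) auto
  then show "F \<in> borel_measurable (gaussian_PiM E)"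
    using assms(2) by (simp cong: measurable_cong_sets)
  show "AE x in gaussian_PiM E. norm (F x) \<le> norm (K * (1 + (\<Sum>e\<in>E. (x e)\<^sup>2)))"
    using assms(3) by (auto intro!: AE_I2 intro: order_trans[OF _ abs_ge_self])
qed

lemma PiM_gaussian_moments:
  assumes E: "finite E" "e \<in> E"
  shows "(\<integral>x. (x e)\<^sup>2 \<partial>gaussian_PiM E) = 1" "(\<integral>x. (x e) ^ 4 \<partial>gaussian_PiM E) = 3"
proof -
  have m: "(\<integral>x. (x e) ^ (2 * k) \<partial>gaussian_PiM E) = fact (2 * k) / (2 ^ k * fact k)" for k
  proof -
    have "(\<integral>x. (x e) ^ (2 * k) \<partial>gaussian_PiM E)
        = (\<integral>t. t ^ (2 * k) \<partial>distr (gaussian_PiM E) std_gaussian (\<lambda>x. x e))"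
      using E by (subst integral_distr) auto
    also have "\<dots> = (\<integral>t. t ^ (2 * k) \<partial>std_gaussian)"
      using E by (subst distr_PiM_component) (auto simp: prob_space_std_gaussian)
    also have "\<dots> = fact (2 * k) / (2 ^ k * fact k)"
      by (subst integral_density) (auto simp: integral_std_normal_moment_even)
    finally show ?thesis .
  qed
  show "(\<integral>x. (x e)\<^sup>2 \<partial>gaussian_PiM E) = 1" "(\<integral>x. (x e) ^ 4 \<partial>gaussian_PiM E) = 3"
    using m[of 1] m[of 2] by (simp_all add: fact_numeral)
qed

text \<open>The diagonal value is 3 - 2 + 1. Off the diagonal, integration by parts in the
  coordinate \<open>d\<close> turns \<open>(x d)\<^sup>2 * (x e)\<^sup>2\<close> into
  \<open>(x e)\<^sup>2\<close>, so the mixed moment is 1 and the centred product integrates to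
  0.\<close>

lemma PiM_gaussian_chisq_orthogonal:
  assumes E: "finite E" "d \<in> E" "e \<in> E"
  shows "integrable (gaussian_PiM E) (\<lambda>x. ((x d)\<^sup>2 - 1) * ((x e)\<^sup>2 - 1))"
    and "(\<integral>x. ((x d)\<^sup>2 - 1) * ((x e)\<^sup>2 - 1) \<partial>gaussian_PiM E) = (if d = e then 2 else 0)"
proof -
  interpret P: prob_space "gaussian_PiM E"
    by (intro prob_space_PiM prob_space_std_gaussian)
  note [simp] = integrable_PiM_gaussian_power E
  have [measurable]: "(\<lambda>x. x e') \<in> borel_measurable (gaussian_PiM E)" if "e' \<in> E" for e'
    using that by measurable
  have prod: "integrable (gaussian_PiM E) (\<lambda>x. (x d)\<^sup>2 * (x e)\<^sup>2)"
  proof (rule Bochner_Integration.integrable_bound)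
    show "integrable (gaussian_PiM E) (\<lambda>x. (x d) ^ 4 + (x e) ^ 4)" by simp
    show "AE x in gaussian_PiM E. norm ((x d)\<^sup>2 * (x e)\<^sup>2) \<le> norm ((x d) ^ 4 + (x e) ^ 4)"
    proof (rule AE_I2)
      fix x :: "'a \<Rightarrow> real"
      \<comment> \<open>With A and B the two squares, the right-hand side is 2 (A^2 + B^2 - A B), so
        A B is at most A^2 + B^2.\<close>
      have "0 \<le> ((x d)\<^sup>2 - (x e)\<^sup>2)\<^sup>2 + (x d) ^ 4 + (x e) ^ 4" by simp
      then show "norm ((x d)\<^sup>2 * (x e)\<^sup>2) \<le> norm ((x d) ^ 4 + (x e) ^ 4)"
        by (simp add: power2_diff)
    qed
  qed simp
  have split: "(\<lambda>x. ((x d)\<^sup>2 - 1) * ((x e)\<^sup>2 - 1)) = (\<lambda>x. (x d)\<^sup>2 * (x e)\<^sup>2 - (x d)\<^sup>2 - (x e)\<^sup>2 + (1::real))"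
    by (auto simp: algebra_simps)
  show "integrable (gaussian_PiM E) (\<lambda>x. ((x d)\<^sup>2 - 1) * ((x e)\<^sup>2 - 1))"
    unfolding split using prod by simp
  have eq: "(\<integral>x. ((x d)\<^sup>2 - 1) * ((x e)\<^sup>2 - 1) \<partial>gaussian_PiM E)
      = (\<integral>x. (x d)\<^sup>2 * (x e)\<^sup>2 \<partial>gaussian_PiM E) - 1"
    unfolding split using prod by (simp add: PiM_gaussian_moments P.prob_space)
  show "(\<integral>x. ((x d)\<^sup>2 - 1) * ((x e)\<^sup>2 - 1) \<partial>gaussian_PiM E) = (if d = e then 2 else 0)"
  proof (cases "d = e")
    case True
    then show ?thesis
      unfolding eq by (simp add: PiM_gaussian_moments flip: power_add)
  next
    case False
    have "(\<integral>x. x d * (x d * (x e)\<^sup>2) \<partial>gaussian_PiM E) = (\<integral>x. (x e)\<^sup>2 \<partial>gaussian_PiM E)"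
    proof (rule PiM_gaussian_ibp)
      fix x :: "'a \<Rightarrow> real" and t
      show "((\<lambda>t. (x(d := t)) d * ((x(d := t)) e)\<^sup>2) has_real_derivative ((x(d := t)) e)\<^sup>2) (at t)"
        using False by (auto intro!: derivative_eq_intros)
      show "isCont (\<lambda>t. ((x(d := t)) e)\<^sup>2) t"
        using False by auto
      show "\<exists>K. \<forall>t. \<bar>(x(d := t)) d * ((x(d := t)) e)\<^sup>2\<bar> \<le> K * (1 + \<bar>t\<bar>)"
        using False by (auto simp: abs_mult algebra_simps intro!: exI[of _ "(x e)\<^sup>2"])
    qed (use prod integrable_PiM_gaussian_power[of e E 2] E in \<open>auto simp: power2_eq_square mult_ac\<close>)
    then show ?thesis
      unfolding eq using False PiM_gaussian_moments(1)[OF E(1,3)] by (simp add: power2_eq_square mult_ac)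
  qed
qed

text \<open>The L1 norm is at most the L2 norm, and by orthogonality the square of the latter is
  \<open>2 * (\<Sum>e\<in>E. (a e)\<^sup>2)\<close>. This is the source of the constant
  \<open>sqrt 2\<close> in the theorem.\<close>

lemma PiM_gaussian_chisq_L1:
  fixes a :: "'e \<Rightarrow> real"
  assumes E: "finite E"
  defines "X \<equiv> \<lambda>x. \<Sum>e\<in>E. a e * ((x e)\<^sup>2 - 1)"
  shows "integrable (gaussian_PiM E) X" "(\<integral>x. \<bar>X x\<bar> \<partial>gaussian_PiM E) \<le> sqrt 2 * L2_set a E"
proof -
  interpret P: prob_space "gaussian_PiM E"
    by (intro prob_space_PiM prob_space_std_gaussian)
  show int: "integrable (gaussian_PiM E) X"
    unfolding X_def using E
    by (intro Bochner_Integration.integrable_sum integrable_mult_right Bochner_Integration.integrable_diff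
        integrable_PiM_gaussian_power) auto
  have sq: "(\<lambda>x. (X x)\<^sup>2) = (\<lambda>x. \<Sum>d\<in>E. \<Sum>e\<in>E. a d * a e * (((x d)\<^sup>2 - 1) * ((x e)\<^sup>2 - 1)))"
    unfolding X_def by (simp add: power2_eq_square sum_product mult_ac)
  have int2: "integrable (gaussian_PiM E) (\<lambda>x. (X x)\<^sup>2)"
    unfolding sq using E
    by (intro Bochner_Integration.integrable_sum integrable_mult_right PiM_gaussian_chisq_orthogonal)
  have "(\<integral>x. (X x)\<^sup>2 \<partial>gaussian_PiM E) = (\<Sum>d\<in>E. \<Sum>e\<in>E. a d * a e * (if d = e then 2 else 0))"
    unfolding sq using E
    by (simp add: PiM_gaussian_chisq_orthogonal Bochner_Integration.integral_sum)
  also have "\<dots> = 2 * (\<Sum>e\<in>E. (a e)\<^sup>2)"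
    using E by (simp add: sum_distrib_left power2_eq_square if_distrib sum.delta mult_ac cong: if_cong)
  also have "\<dots> = (sqrt 2 * L2_set a E)\<^sup>2"
    by (simp add: L2_set_def power_mult_distrib sum_nonneg)
  \<comment> \<open>Cauchy-Schwarz is used in the form that the variance of
    \<open>\<bar>X\<bar>\<close> is nonnegative.\<close>
  finally have "(\<integral>x. \<bar>X x\<bar> \<partial>gaussian_PiM E)\<^sup>2 \<le> (sqrt 2 * L2_set a E)\<^sup>2"
    using P.variance_positive[of "\<lambda>x. \<bar>X x\<bar>"] int int2 by (subst (asm) P.variance_eq) auto
  then show "(\<integral>x. \<bar>X x\<bar> \<partial>gaussian_PiM E) \<le> sqrt 2 * L2_set a E"
    by (rule power2_le_imp_le) simp
qed

section \<open>Gibbs averages for fixed disorder\<close>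

text \<open>The class is closed under sums, products and \<open>exp\<close>, and its members are
  integrable for finite measures, so closure rules discharge the side conditions of the
  differentiations below. The bound is asked only on \<open>space M\<close>, because
  \<open>f\<close> is controlled only there.\<close>

definition bounded_borel :: "'s measure \<Rightarrow> ('s \<Rightarrow> real) set" where
  "bounded_borel M = {h \<in> borel_measurable M. \<exists>B. \<forall>\<sigma>\<in>space M. \<bar>h \<sigma>\<bar> \<le> B}"

lemma bounded_borel_measurable[measurable_dest]: "h \<in> bounded_borel M \<Longrightarrow> h \<in> borel_measurable M"
  by (simp add: bounded_borel_def)

lemma bounded_borelE:
  assumes "h \<in> bounded_borel M"
  obtains B where "0 \<le> B" "\<And>\<sigma>. \<sigma> \<in> space M \<Longrightarrow> \<bar>h \<sigma>\<bar> \<le> B"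
proof -
  obtain B where B: "\<forall>\<sigma>\<in>space M. \<bar>h \<sigma>\<bar> \<le> B"
    using assms by (auto simp: bounded_borel_def)
  show thesis
    by (rule that[of "max B 0"]) (use B in \<open>auto simp: le_max_iff_disj\<close>)
qed

lemma bounded_borelI:
  "h \<in> borel_measurable M \<Longrightarrow> (\<And>\<sigma>. \<sigma> \<in> space M \<Longrightarrow> \<bar>h \<sigma>\<bar> \<le> B) \<Longrightarrow> h \<in> bounded_borel M"
  by (auto simp: bounded_borel_def)

lemma bounded_borel_const[simp, intro]: "(\<lambda>_. c) \<in> bounded_borel M"
  by (rule bounded_borelI[of _ _ "\<bar>c\<bar>"]) auto

lemma bounded_borel_mult[intro]:
  assumes "h \<in> bounded_borel M" "k \<in> bounded_borel M"
  shows "(\<lambda>\<sigma>. h \<sigma> * k \<sigma>) \<in> bounded_borel M"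
proof -
  obtain B where B: "0 \<le> B" "\<And>\<sigma>. \<sigma> \<in> space M \<Longrightarrow> \<bar>h \<sigma>\<bar> \<le> B"
    using assms(1) bounded_borelE by blast
  obtain C where C: "\<And>\<sigma>. \<sigma> \<in> space M \<Longrightarrow> \<bar>k \<sigma>\<bar> \<le> C"
    using assms(2) by (elim bounded_borelE) blast
  have "(\<lambda>\<sigma>. h \<sigma> * k \<sigma>) \<in> borel_measurable M"
    using assms by measurable
  then show ?thesis
    by (rule bounded_borelI[of _ _ "B * C"]) (auto simp: abs_mult intro!: mult_mono B C)
qed

lemma bounded_borel_add[intro]:
  assumes "h \<in> bounded_borel M" "k \<in> bounded_borel M"
  shows "(\<lambda>\<sigma>. h \<sigma> + k \<sigma>) \<in> bounded_borel M"
proof -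
  obtain B where B: "0 \<le> B" "\<And>\<sigma>. \<sigma> \<in> space M \<Longrightarrow> \<bar>h \<sigma>\<bar> \<le> B"
    using assms(1) bounded_borelE by blast
  obtain C where C: "\<And>\<sigma>. \<sigma> \<in> space M \<Longrightarrow> \<bar>k \<sigma>\<bar> \<le> C"
    using assms(2) by (elim bounded_borelE) blast
  have "(\<lambda>\<sigma>. h \<sigma> + k \<sigma>) \<in> borel_measurable M"
    using assms by measurable
  then show ?thesis
    by (rule bounded_borelI[of _ _ "B + C"]) (auto intro!: order_trans[OF abs_triangle_ineq] add_mono B C)
qed

lemma bounded_borel_sum[intro]:
  assumes "\<And>e. e \<in> E \<Longrightarrow> h e \<in> bounded_borel M"
  shows "(\<lambda>\<sigma>. \<Sum>e\<in>E. h e \<sigma>) \<in> bounded_borel M"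
  using assms by (induction E rule: infinite_finite_induct) auto

lemma bounded_borel_exp[intro]:
  assumes "h \<in> bounded_borel M"
  shows "(\<lambda>\<sigma>. exp (h \<sigma>)) \<in> bounded_borel M"
proof -
  obtain B where B: "\<And>\<sigma>. \<sigma> \<in> space M \<Longrightarrow> \<bar>h \<sigma>\<bar> \<le> B"
    using assms by (elim bounded_borelE) blast
  have "(\<lambda>\<sigma>. exp (h \<sigma>)) \<in> borel_measurable M"
    using assms by measurable
  then show ?thesis
    by (rule bounded_borelI[of _ _ "exp B"]) (auto dest: B)
qed

lemma (in finite_measure) integrable_bounded_borel:
  assumes "h \<in> bounded_borel M"
  shows "integrable M h"
proof -
  obtain B where "\<And>\<sigma>. \<sigma> \<in> space M \<Longrightarrow> \<bar>h \<sigma>\<bar> \<le> B"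
    using assms by (elim bounded_borelE) blast
  then show ?thesis
    using assms by (intro integrable_const_bound[of _ B]) (auto simp: bounded_borel_def)
qed

section \<open>Differentiation under the integral sign\<close>

lemma abs_exp_minus_one_minus_id_le:
  fixes x :: real
  assumes "\<bar>x\<bar> \<le> 1"
  shows "\<bar>exp x - 1 - x\<bar> \<le> x\<^sup>2"
proof -
  have "1 + x \<le> exp x" by simp
  moreover have "0 \<le> x\<^sup>2" by simp
  moreover have "exp x \<le> 1 + x + x\<^sup>2"
  proof (cases "0 \<le> x")
    case True
    then show ?thesis using assms by (intro exp_bound) auto
  next
    case False
    \<comment> \<open>The geometric series is cut after the square: (1 + x + x^2)(1 - x) = 1 - x^3,
      which is at least 1 for negative x.\<close>
    have "1 / (1 - x) \<le> 1 + x + x\<^sup>2"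
    proof -
      have "0 \<le> - (x ^ 3)" using False by (simp add: odd_power_less_zero less_imp_le)
      then have "1 \<le> (1 + x + x\<^sup>2) * (1 - x)" by (simp add: algebra_simps power2_eq_square power3_eq_cube)
      then show ?thesis using False by (simp add: field_simps)
    qed
    moreover have "exp x \<le> 1 / (1 - x)"
    proof -
      have "1 - x \<le> exp (- x)" using exp_ge_add_one_self[of "- x"] by simp
      then have "inverse (exp (- x)) \<le> inverse (1 - x)"
        using False by (intro le_imp_inverse_le) auto
      then show ?thesis by (simp add: exp_minus field_simps)
    qed
    ultimately show ?thesis by linarith
  qed
  ultimately show ?thesis by linarith
qed

text \<open>The second-order remainder of the exponential, bounded uniformly on the space, makes the
  error of the linear approximation at most \<open>K * s\<^sup>2\<close>; dividing by
  \<open>s\<close> gives the derivative.\<close>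

lemma (in finite_measure) laplace_has_derivative:
  assumes h: "h \<in> bounded_borel M" and w: "w \<in> bounded_borel M"
  shows "((\<lambda>t. \<integral>\<sigma>. h \<sigma> * exp (t * w \<sigma>) \<partial>M) has_real_derivative (\<integral>\<sigma>. h \<sigma> * w \<sigma> * exp (t * w \<sigma>) \<partial>M)) (at t)"
proof -
  have hw: "(\<lambda>\<sigma>. h \<sigma> * exp (t * w \<sigma>)) \<in> bounded_borel M" for t
    by (intro bounded_borel_mult bounded_borel_exp bounded_borel_const h w)
  have hww: "(\<lambda>\<sigma>. h \<sigma> * w \<sigma> * exp (t * w \<sigma>)) \<in> bounded_borel M"
    by (intro bounded_borel_mult bounded_borel_exp bounded_borel_const h w)
  obtain B where B: "0 \<le> B" "\<And>\<sigma>. \<sigma> \<in> space M \<Longrightarrow> \<bar>h \<sigma> * exp (t * w \<sigma>)\<bar> \<le> B"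
    using bounded_borelE[OF hw[of t]] by metis
  obtain C where C: "0 \<le> C" "\<And>\<sigma>. \<sigma> \<in> space M \<Longrightarrow> \<bar>w \<sigma>\<bar> \<le> C"
    using bounded_borelE[OF w] by metis
  define N where "N s = (\<integral>\<sigma>. h \<sigma> * exp (s * w \<sigma>) \<partial>M)" for s
  define D where "D = (\<integral>\<sigma>. h \<sigma> * w \<sigma> * exp (t * w \<sigma>) \<partial>M)"
  define K where "K = measure M (space M) * (B * C\<^sup>2)"
  \<comment> \<open>The condition on \<open>s\<close> ensures
    \<open>\<bar>s * w \<sigma>\<bar> \<le> 1\<close>, the range in which the remainder estimate for
    \<open>exp\<close> holds.\<close>
  have bound: "\<bar>N (t + s) - N t - s * D\<bar> \<le> K * s\<^sup>2" if s: "\<bar>s\<bar> * C \<le> 1" for s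
  proof -
    have "N (t + s) - N t - s * D =
        (\<integral>\<sigma>. h \<sigma> * exp (t * w \<sigma>) * (exp (s * w \<sigma>) - 1 - s * w \<sigma>) \<partial>M)"
    proof -
      have i: "integrable M (\<lambda>\<sigma>. h \<sigma> * exp ((t + s) * w \<sigma>))" "integrable M (\<lambda>\<sigma>. h \<sigma> * exp (t * w \<sigma>))"
         "integrable M (\<lambda>\<sigma>. h \<sigma> * w \<sigma> * exp (t * w \<sigma>))"
        by (intro integrable_bounded_borel hw hww)+
      have "N (t + s) - N t - s * D = (\<integral>\<sigma>. h \<sigma> * exp ((t + s) * w \<sigma>) - h \<sigma> * exp (t * w \<sigma>)
          - s * (h \<sigma> * w \<sigma> * exp (t * w \<sigma>)) \<partial>M)"
        unfolding N_def D_def using i by simp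
      also have "\<dots> = (\<integral>\<sigma>. h \<sigma> * exp (t * w \<sigma>) * (exp (s * w \<sigma>) - 1 - s * w \<sigma>) \<partial>M)"
        by (intro Bochner_Integration.integral_cong refl) (simp add: algebra_simps exp_add)
      finally show ?thesis .
    qed
    also have "\<bar>\<dots>\<bar> \<le> (\<integral>\<sigma>. B * (C\<^sup>2 * s\<^sup>2) \<partial>M)"
    proof (rule order_trans[OF integral_abs_bound], rule integral_mono')
      fix \<sigma> assume \<sigma>: "\<sigma> \<in> space M"
      have sw: "\<bar>s * w \<sigma>\<bar> \<le> \<bar>s\<bar> * C"
        using C(2)[OF \<sigma>] by (auto simp: abs_mult intro: mult_left_mono)
      then have "\<bar>exp (s * w \<sigma>) - 1 - s * w \<sigma>\<bar> \<le> (s * w \<sigma>)\<^sup>2"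
        using s by (intro abs_exp_minus_one_minus_id_le) auto
      also have "\<dots> \<le> (\<bar>s\<bar> * C)\<^sup>2"
        using power_mono[OF sw, of 2] by simp
      finally have "\<bar>exp (s * w \<sigma>) - 1 - s * w \<sigma>\<bar> \<le> C\<^sup>2 * s\<^sup>2"
        by (simp add: power_mult_distrib mult_ac)
      then show "\<bar>h \<sigma> * exp (t * w \<sigma>) * (exp (s * w \<sigma>) - 1 - s * w \<sigma>)\<bar> \<le> B * (C\<^sup>2 * s\<^sup>2)"
        using B(2)[OF \<sigma>] B(1) by (subst abs_mult) (intro mult_mono; simp)
    qed (use B in auto)
    also have "\<dots> = K * s\<^sup>2"
      by (simp add: K_def)
    finally show ?thesis .
  qed
  have "(\<lambda>s. (N (t + s) - N t) / s - D) \<midarrow>0\<rightarrow> 0"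
  proof (rule Lim_null_comparison)
    \<comment> \<open>The radius uses \<open>C + 1\<close> because \<open>C\<close> may be
      0.\<close>
    have "\<forall>\<^sub>F s in at 0. s \<noteq> 0 \<and> \<bar>s\<bar> < 1 / (C + 1)"
      unfolding eventually_at using C by (intro exI[of _ "1 / (C + 1)"]) auto
    then show "\<forall>\<^sub>F s in at 0. norm ((N (t + s) - N t) / s - D) \<le> K * \<bar>s\<bar>"
    proof eventually_elim
      case (elim s)
      then have s: "s \<noteq> 0" "\<bar>s\<bar> * (C + 1) < 1" using C by (auto simp: field_simps)
      then have "\<bar>s\<bar> * C \<le> 1" by (simp add: algebra_simps)
      from bound[OF this] have "\<bar>(N (t + s) - N t - s * D) / s\<bar> \<le> K * s\<^sup>2 / \<bar>s\<bar>"
        using s by (simp add: divide_right_mono)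
      also have "K * s\<^sup>2 / \<bar>s\<bar> = K * \<bar>s\<bar>"
        using s by (simp add: power2_eq_square abs_if)
      finally show ?case using s by (simp add: diff_divide_distrib)
    qed
    show "(\<lambda>s. K * \<bar>s\<bar>) \<midarrow>0\<rightarrow> 0"
      by (auto intro!: tendsto_eq_intros)
  qed
  then show ?thesis
    unfolding DERIV_def N_def[symmetric] D_def[symmetric] by (simp add: LIM_zero_iff)
qed

section \<open>Bounded functions times quadratic polynomials\<close>

lemma quadratic_bounds:
  fixes x :: "'e \<Rightarrow> real"
  assumes E: "finite E" "d \<in> E" "e \<in> E"
  shows "\<bar>x d * x e\<bar> \<le> 1 + (\<Sum>e\<in>E. (x e)\<^sup>2)" "\<bar>x e\<bar> \<le> 1 + (\<Sum>e\<in>E. (x e)\<^sup>2)"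
    "\<bar>(x e)\<^sup>2 - 1\<bar> \<le> 1 + (\<Sum>e\<in>E. (x e)\<^sup>2)"
proof -
  have le: "(x i)\<^sup>2 \<le> (\<Sum>e\<in>E. (x e)\<^sup>2)" if "i \<in> E" for i
    using member_le_sum[of i E "\<lambda>e. (x e)\<^sup>2"] that E by simp
  have "0 \<le> (\<bar>x d\<bar> - \<bar>x e\<bar>)\<^sup>2" by simp
  then have "2 * \<bar>x d * x e\<bar> \<le> (x d)\<^sup>2 + (x e)\<^sup>2"
    by (simp add: power2_diff abs_mult)
  then show "\<bar>x d * x e\<bar> \<le> 1 + (\<Sum>e\<in>E. (x e)\<^sup>2)"
    using le[OF E(2)] le[OF E(3)] by linarith
  have "0 \<le> (\<bar>x e\<bar> - 1)\<^sup>2" by simp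
  then have "2 * \<bar>x e\<bar> \<le> (x e)\<^sup>2 + 1"
    by (simp add: power2_diff)
  then show "\<bar>x e\<bar> \<le> 1 + (\<Sum>e\<in>E. (x e)\<^sup>2)"
    using le[OF E(3)] by linarith
  show "\<bar>(x e)\<^sup>2 - 1\<bar> \<le> 1 + (\<Sum>e\<in>E. (x e)\<^sup>2)"
    using le[OF E(3)] zero_le_power2[of "x e"] by linarith
qed

lemma integrable_PiM_gaussian_quadratic:
  assumes "finite E" "p \<in> borel_measurable (\<Pi>\<^sub>M e\<in>E. borel)" "c \<in> borel_measurable (\<Pi>\<^sub>M e\<in>E. borel)"
    and p: "\<And>x. \<bar>p x\<bar> \<le> 1 + (\<Sum>e\<in>E. (x e)\<^sup>2)" and c: "\<And>x. \<bar>c x\<bar> \<le> (B::real)"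
  shows "integrable (gaussian_PiM E) (\<lambda>x. p x * c x)"
proof (rule integrable_PiM_gaussian_bound)
  show "\<bar>p x * c x\<bar> \<le> B * (1 + (\<Sum>e\<in>E. (x e)\<^sup>2))" for x
  proof -
    have "\<bar>p x\<bar> * \<bar>c x\<bar> \<le> (1 + (\<Sum>e\<in>E. (x e)\<^sup>2)) * B"
      by (intro mult_mono p c) (auto intro!: add_nonneg_nonneg sum_nonneg)
    then show ?thesis by (simp add: abs_mult mult_ac)
  qed
qed (use assms in measurable)

section \<open>Frozen disorder: Gibbs averages as functions of the Gaussian vector\<close>

locale gibbs_system = finite_measure \<mu> for \<mu> :: "'s measure" +
  fixes E :: "'e set" and f :: "'e \<Rightarrow> 's \<Rightarrow> real" and \<gamma> :: real
  assumes finite_E: "finite E"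
    and f_measurable: "e \<in> E \<Longrightarrow> f e \<in> borel_measurable \<mu>"
    and f_bound: "e \<in> E \<Longrightarrow> \<sigma> \<in> space \<mu> \<Longrightarrow> \<bar>f e \<sigma>\<bar> \<le> 1"
    and nonzero: "emeasure \<mu> (space \<mu>) \<noteq> 0"
begin

text \<open>The unnormalised Gibbs average; at the constant function 1 it is the partition function.
  Integrating against the fixed measure \<open>\<mu>\<close> leaves \<open>x\<close> only in the
  integrand, where it can be differentiated.\<close>

definition weighted :: "('s \<Rightarrow> real) \<Rightarrow> ('e \<Rightarrow> real) \<Rightarrow> real" where
  "weighted h x = (\<integral>\<sigma>. h \<sigma> * exp (\<gamma> * field_Y E x f \<sigma>) \<partial>\<mu>)"

definition avg :: "('s \<Rightarrow> real) \<Rightarrow> ('e \<Rightarrow> real) \<Rightarrow> real" where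
  "avg h x = weighted h x / weighted (\<lambda>_. 1) x"

definition cov :: "('s \<Rightarrow> real) \<Rightarrow> ('s \<Rightarrow> real) \<Rightarrow> ('e \<Rightarrow> real) \<Rightarrow> real" where
  "cov u v x = avg (\<lambda>\<sigma>. u \<sigma> * v \<sigma>) x - avg u x * avg v x"

text \<open>The joint third cumulant of \<open>u\<close>, \<open>v\<close>, \<open>w\<close>; its symmetry links the two integrations by parts.\<close>

definition cum3 :: "('s \<Rightarrow> real) \<Rightarrow> ('s \<Rightarrow> real) \<Rightarrow> ('s \<Rightarrow> real) \<Rightarrow> ('e \<Rightarrow> real) \<Rightarrow> real" where
  "cum3 u v w x = avg (\<lambda>\<sigma>. u \<sigma> * v \<sigma> * w \<sigma>) x - avg (\<lambda>\<sigma>. u \<sigma> * v \<sigma>) x * avg w x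
     - avg (\<lambda>\<sigma>. u \<sigma> * w \<sigma>) x * avg v x - avg u x * avg (\<lambda>\<sigma>. v \<sigma> * w \<sigma>) x
     + 2 * avg u x * avg v x * avg w x"

lemma f_bounded_borel: "e \<in> E \<Longrightarrow> f e \<in> bounded_borel \<mu>"
  by (rule bounded_borelI[OF f_measurable f_bound])

lemma field_Y_bounded_borel: "field_Y E x f \<in> bounded_borel \<mu>"
  unfolding field_Y_def[abs_def]
  by (intro bounded_borel_sum bounded_borel_mult bounded_borel_const f_bounded_borel)

lemma exp_field_Y_bounded_borel: "(\<lambda>\<sigma>. exp (\<gamma> * field_Y E x f \<sigma>)) \<in> bounded_borel \<mu>"
  by (intro bounded_borel_exp bounded_borel_mult bounded_borel_const field_Y_bounded_borel)

lemma integrable_weighted: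
  "h \<in> bounded_borel \<mu> \<Longrightarrow> integrable \<mu> (\<lambda>\<sigma>. h \<sigma> * exp (\<gamma> * field_Y E x f \<sigma>))"
  by (intro integrable_bounded_borel bounded_borel_mult exp_field_Y_bounded_borel)

text \<open>A strictly positive integrand with zero integral would force \<open>\<mu>\<close> to be
  null, against \<open>nonzero\<close>.\<close>

lemma weighted_one_pos: "weighted (\<lambda>_. 1) x > 0"
proof -
  have int: "integrable \<mu> (\<lambda>\<sigma>. exp (\<gamma> * field_Y E x f \<sigma>))"
    by (intro integrable_bounded_borel exp_field_Y_bounded_borel)
  have "(\<integral>\<sigma>. exp (\<gamma> * field_Y E x f \<sigma>) \<partial>\<mu>) \<noteq> 0"
  proof
    assume "(\<integral>\<sigma>. exp (\<gamma> * field_Y E x f \<sigma>) \<partial>\<mu>) = 0"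
    then have "AE \<sigma> in \<mu>. False"
      using int by (subst (asm) integral_nonneg_eq_0_iff_AE) auto
    then show False
      using nonzero by (auto simp: AE_iff_measurable[OF sets.top])
  qed
  moreover have "(\<integral>\<sigma>. exp (\<gamma> * field_Y E x f \<sigma>) \<partial>\<mu>) \<ge> 0"
    by (rule integral_nonneg_AE) simp
  ultimately have "(\<integral>\<sigma>. exp (\<gamma> * field_Y E x f \<sigma>) \<partial>\<mu>) > 0"
    by linarith
  then show ?thesis by (simp add: weighted_def)
qed

section \<open>Derivatives in the Gaussian coordinates\<close>

lemma weighted_has_derivative:
  assumes h: "h \<in> bounded_borel \<mu>" and e: "e \<in> E"
  shows "((\<lambda>t. weighted h (x(e := t))) has_real_derivative
    \<gamma> * weighted (\<lambda>\<sigma>. h \<sigma> * f e \<sigma>) (x(e := t))) (at t)"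
proof -
  \<comment> \<open>\<open>r\<close> collects the coordinates other than \<open>e\<close>, so
    \<open>t\<close> enters only through the factor
    \<open>exp (t * (\<gamma> * f e \<sigma>))\<close>, as \<open>laplace_has_derivative\<close>
    requires.\<close>
  define r where "r = (\<lambda>\<sigma>. exp (\<gamma> * (\<Sum>e'\<in>E - {e}. x e' * f e' \<sigma>)))"
  have r: "r \<in> bounded_borel \<mu>"
    unfolding r_def
    by (intro bounded_borel_exp bounded_borel_sum bounded_borel_mult bounded_borel_const f_bounded_borel) auto
  have Y: "exp (\<gamma> * field_Y E (x(e := t)) f \<sigma>) = r \<sigma> * exp (t * (\<gamma> * f e \<sigma>))" for t \<sigma>
    unfolding field_Y_def r_def
    by (subst sum.remove[OF finite_E e]) (simp add: algebra_simps exp_add)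
  have "((\<lambda>t. \<integral>\<sigma>. h \<sigma> * r \<sigma> * exp (t * (\<gamma> * f e \<sigma>)) \<partial>\<mu>) has_real_derivative
      (\<integral>\<sigma>. h \<sigma> * r \<sigma> * (\<gamma> * f e \<sigma>) * exp (t * (\<gamma> * f e \<sigma>)) \<partial>\<mu>)) (at t)"
    by (intro laplace_has_derivative bounded_borel_mult bounded_borel_const f_bounded_borel h r e)
  then show ?thesis
    unfolding weighted_def Y by (simp add: mult_ac flip: integral_mult_right_zero)
qed

text \<open>By the quotient rule, the numerator contributes the average of \<open>h\<close> times
  \<open>f e\<close> and the partition function the product of averages: the derivative is
  \<open>\<gamma>\<close> times a covariance.\<close>

lemma avg_has_derivative:
  assumes h: "h \<in> bounded_borel \<mu>" and e: "e \<in> E"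
  shows "((\<lambda>t. avg h (x(e := t))) has_real_derivative
    \<gamma> * (avg (\<lambda>\<sigma>. h \<sigma> * f e \<sigma>) (x(e := t)) - avg h (x(e := t)) * avg (f e) (x(e := t)))) (at t)"
proof -
  have Z: "weighted (\<lambda>_. 1) (x(e := t)) \<noteq> 0"
    using weighted_one_pos[of "x(e := t)"] by linarith
  note D = DERIV_divide[OF weighted_has_derivative[OF h e, of x t]
      weighted_has_derivative[OF bounded_borel_const e, of 1 x t] Z]
  have quotient: "(\<gamma> * a * c - b * (\<gamma> * d)) / (c * c) = \<gamma> * (a / c - b / c * (d / c))" if "c \<noteq> 0" for a b c d
    using that by (simp add: field_simps)
  show ?thesis
    unfolding avg_def by (rule DERIV_cong[OF D]) (simp only: quotient[OF Z] mult_1)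
qed

lemma avg_bound:
  assumes h: "h \<in> borel_measurable \<mu>" and B: "\<And>\<sigma>. \<sigma> \<in> space \<mu> \<Longrightarrow> \<bar>h \<sigma>\<bar> \<le> B"
  shows "\<bar>avg h x\<bar> \<le> B"
proof -
  have "\<bar>weighted h x\<bar> \<le> (\<integral>\<sigma>. B * exp (\<gamma> * field_Y E x f \<sigma>) \<partial>\<mu>)"
    unfolding weighted_def
    by (rule order_trans[OF integral_abs_bound], intro integral_mono integrable_abs integrable_weighted
          bounded_borelI[OF h B] bounded_borel_const)
       (auto intro!: mult_right_mono B simp: abs_mult)
  also have "\<dots> = B * weighted (\<lambda>_. 1) x"
    by (simp add: weighted_def)
  finally show ?thesis
    unfolding avg_def abs_divide abs_of_pos[OF weighted_one_pos] pos_divide_le_eq[OF weighted_one_pos] .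
qed

lemma cov_has_derivative:
  assumes u: "u \<in> bounded_borel \<mu>" and v: "v \<in> bounded_borel \<mu>" and e: "e \<in> E"
  shows "((\<lambda>t. cov u v (x(e := t))) has_real_derivative \<gamma> * cum3 u v (f e) (x(e := t))) (at t)"
  unfolding cov_def
  by (rule DERIV_cong[OF DERIV_diff[OF avg_has_derivative[OF bounded_borel_mult[OF u v] e]
        DERIV_mult[OF avg_has_derivative[OF u e] avg_has_derivative[OF v e]]]])
     (simp add: cum3_def algebra_simps)

lemma cum3_isCont:
  assumes "u \<in> bounded_borel \<mu>" "v \<in> bounded_borel \<mu>" "w \<in> bounded_borel \<mu>" "e \<in> E"
  shows "isCont (\<lambda>t. cum3 u v w (x(e := t))) t"
  unfolding cum3_def
  by (intro continuous_intros DERIV_isCont[OF avg_has_derivative] bounded_borel_mult assms)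

text \<open>It identifies the derivative of \<open>cov (f d) (f e)\<close> in direction
  \<open>d\<close> with that of \<open>cov (f d) (f d)\<close> in direction
  \<open>e\<close>.\<close>

lemma cum3_commute: "cum3 u v w x = cum3 u w v x"
  by (simp add: cum3_def mult_ac)

section \<open>Measurability and uniform bounds\<close>

lemma weighted_measurable:
  assumes h: "h \<in> borel_measurable \<mu>"
  shows "weighted h \<in> borel_measurable (\<Pi>\<^sub>M e\<in>E. borel)"
proof -
  have "(\<lambda>(x, \<sigma>). h \<sigma> * exp (\<gamma> * field_Y E x f \<sigma>)) \<in> borel_measurable ((\<Pi>\<^sub>M e\<in>E. borel) \<Otimes>\<^sub>M \<mu>)"
    unfolding field_Y_def using h f_measurable by measurable
  then show ?thesis
    unfolding weighted_def[abs_def] by (rule borel_measurable_lebesgue_integral)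
qed

lemma avg_measurable:
  "h \<in> borel_measurable \<mu> \<Longrightarrow> avg h \<in> borel_measurable (\<Pi>\<^sub>M e\<in>E. borel)"
  unfolding avg_def[abs_def] by (intro borel_measurable_divide weighted_measurable) auto

lemma cov_measurable:
  assumes [measurable]: "u \<in> borel_measurable \<mu>" "v \<in> borel_measurable \<mu>"
  shows "cov u v \<in> borel_measurable (\<Pi>\<^sub>M e\<in>E. borel)"
  unfolding cov_def[abs_def]
  by (intro borel_measurable_diff borel_measurable_times avg_measurable) measurable

lemma cum3_measurable:
  assumes [measurable]: "u \<in> borel_measurable \<mu>" "v \<in> borel_measurable \<mu>" "w \<in> borel_measurable \<mu>"
  shows "cum3 u v w \<in> borel_measurable (\<Pi>\<^sub>M e\<in>E. borel)"
  unfolding cum3_def[abs_def]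
  by (intro borel_measurable_diff borel_measurable_add borel_measurable_times avg_measurable
      borel_measurable_const) measurable


lemma cov_bound:
  assumes u: "u \<in> borel_measurable \<mu>" "\<And>\<sigma>. \<sigma> \<in> space \<mu> \<Longrightarrow> \<bar>u \<sigma>\<bar> \<le> 1"
    and v: "v \<in> borel_measurable \<mu>" "\<And>\<sigma>. \<sigma> \<in> space \<mu> \<Longrightarrow> \<bar>v \<sigma>\<bar> \<le> 1"
  shows "\<bar>cov u v x\<bar> \<le> 2"
proof -
  have "\<bar>avg (\<lambda>\<sigma>. u \<sigma> * v \<sigma>) x\<bar> \<le> 1"
    by (intro avg_bound borel_measurable_times u(1) v(1)) (simp add: abs_mult mult_le_one u(2) v(2))
  moreover have "\<bar>avg u x * avg v x\<bar> \<le> 1"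
    unfolding abs_mult by (intro mult_le_one abs_ge_zero avg_bound u v)
  ultimately show ?thesis unfolding cov_def by linarith
qed

text \<open>Each product of averages is at most 1 in absolute value, and the coefficients give 1 + 1
  + 1 + 1 + 2. Like the 2 in \<open>cov_bound\<close>, the value serves only to secure integrability
  and growth conditions.\<close>

lemma cum3_bound:
  assumes u: "u \<in> borel_measurable \<mu>" "\<And>\<sigma>. \<sigma> \<in> space \<mu> \<Longrightarrow> \<bar>u \<sigma>\<bar> \<le> 1"
    and v: "v \<in> borel_measurable \<mu>" "\<And>\<sigma>. \<sigma> \<in> space \<mu> \<Longrightarrow> \<bar>v \<sigma>\<bar> \<le> 1"
    and w: "w \<in> borel_measurable \<mu>" "\<And>\<sigma>. \<sigma> \<in> space \<mu> \<Longrightarrow> \<bar>w \<sigma>\<bar> \<le> 1"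
  shows "\<bar>cum3 u v w x\<bar> \<le> 6"
proof -
  have prod: "\<bar>a * b\<bar> \<le> 1" if "\<bar>a\<bar> \<le> 1" "\<bar>b\<bar> \<le> 1" for a b :: real
    using that by (simp add: abs_mult mult_le_one)
  \<comment> \<open>The unit ball of measurable functions is closed under products, so every average
    in the cumulant is covered by the same bound.\<close>
  define U where "U h \<longleftrightarrow> h \<in> borel_measurable \<mu> \<and> (\<forall>\<sigma>\<in>space \<mu>. \<bar>h \<sigma>\<bar> \<le> 1)" for h :: "'s \<Rightarrow> real"
  have U: "U u" "U v" "U w"
    using u v w by (auto simp: U_def)
  have U_mult: "U (\<lambda>\<sigma>. h \<sigma> * k \<sigma>)" if "U h" "U k" for h k
    using that unfolding U_def by (auto intro!: prod)
  have avg: "\<bar>avg h x\<bar> \<le> 1" if "U h" for h :: "'s \<Rightarrow> real"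
    using that unfolding U_def by (intro avg_bound) auto
  have "\<bar>avg (\<lambda>\<sigma>. u \<sigma> * v \<sigma> * w \<sigma>) x\<bar> \<le> 1"
    "\<bar>avg (\<lambda>\<sigma>. u \<sigma> * v \<sigma>) x * avg w x\<bar> \<le> 1" "\<bar>avg (\<lambda>\<sigma>. u \<sigma> * w \<sigma>) x * avg v x\<bar> \<le> 1"
    "\<bar>avg u x * avg (\<lambda>\<sigma>. v \<sigma> * w \<sigma>) x\<bar> \<le> 1" "\<bar>avg u x * avg v x * avg w x\<bar> \<le> 1"
    by (intro prod avg U_mult U)+
  then show ?thesis unfolding cum3_def by linarith
qed

text \<open>Both the average of the square and the square of the average lie between 0 and 1, so
  their difference is at most 1 in absolute value. Unlike the bounds 2 and 6, this constant enters
  the final estimate.\<close>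

lemma var_bound:
  assumes u: "u \<in> borel_measurable \<mu>" "\<And>\<sigma>. \<sigma> \<in> space \<mu> \<Longrightarrow> \<bar>u \<sigma>\<bar> \<le> 1"
  shows "\<bar>cov u u x\<bar> \<le> 1"
proof -
  have 1: "\<bar>avg (\<lambda>\<sigma>. u \<sigma> * u \<sigma>) x\<bar> \<le> 1"
  proof (rule avg_bound)
    show "\<bar>u \<sigma> * u \<sigma>\<bar> \<le> 1" if "\<sigma> \<in> space \<mu>" for \<sigma>
      unfolding abs_mult using u(2)[OF that] by (intro mult_le_one) auto
  qed (use u in measurable)
  have "\<bar>avg u x\<bar> * \<bar>avg u x\<bar> \<le> 1"
    by (intro mult_le_one abs_ge_zero avg_bound u)
  then have "avg u x * avg u x \<le> 1" by simp
  moreover have "0 \<le> avg (\<lambda>\<sigma>. u \<sigma> * u \<sigma>) x"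
    using weighted_one_pos[of x] unfolding avg_def
    by (auto simp: weighted_def intro!: divide_nonneg_pos integral_nonneg_AE)
  ultimately show ?thesis
    using 1 zero_le_square[of "avg u x"] unfolding cov_def by linarith
qed

section \<open>The fluctuation as a quadratic form in the Gaussian vector\<close>

lemma integral_gibbs_measure:
  assumes h: "h \<in> borel_measurable \<mu>"
  shows "(\<integral>\<sigma>. h \<sigma> \<partial>gibbs_measure \<gamma> (field_Y E x f) \<mu>) = avg h x"
proof -
  have Z: "partition_function \<gamma> (field_Y E x f) \<mu> = weighted (\<lambda>_. 1) x"
    by (simp add: partition_function_def weighted_def)
  have [measurable]: "field_Y E x f \<in> borel_measurable \<mu>"
    using field_Y_bounded_borel by measurable
  have "(\<integral>\<sigma>. h \<sigma> \<partial>gibbs_measure \<gamma> (field_Y E x f) \<mu>)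
      = (\<integral>\<sigma>. (exp (\<gamma> * field_Y E x f \<sigma>) / weighted (\<lambda>_. 1) x) *\<^sub>R h \<sigma> \<partial>\<mu>)"
    unfolding gibbs_measure_def Z using h weighted_one_pos[of x]
    by (intro integral_density) auto
  also have "\<dots> = avg h x"
    unfolding avg_def weighted_def[of h] by (simp add: mult_ac)
  finally show ?thesis .
qed

lemma avg_sum:
  assumes "\<And>i. i \<in> I \<Longrightarrow> h i \<in> bounded_borel \<mu>"
  shows "avg (\<lambda>\<sigma>. \<Sum>i\<in>I. c i * h i \<sigma>) x = (\<Sum>i\<in>I. c i * avg (h i) x)"
proof -
  have "weighted (\<lambda>\<sigma>. \<Sum>i\<in>I. c i * h i \<sigma>) x = (\<integral>\<sigma>. (\<Sum>i\<in>I. c i * (h i \<sigma> * exp (\<gamma> * field_Y E x f \<sigma>))) \<partial>\<mu>)"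
    unfolding weighted_def by (simp add: sum_distrib_right mult.assoc)
  also have "\<dots> = (\<Sum>i\<in>I. c i * weighted (h i) x)"
    unfolding weighted_def using assms
    by (subst Bochner_Integration.integral_sum) (auto intro!: integrable_mult_right integrable_weighted)
  finally show ?thesis
    unfolding avg_def by (simp add: sum_divide_distrib)
qed

lemma gibbs_fluctuation_eq:
  "gibbs_fluctuation E \<gamma> a x f \<mu> = (\<Sum>d\<in>E. \<Sum>e\<in>E. a d * a e * (x d * x e * cov (f d) (f e) x))"
proof -
  have W: "field_W E a x f \<in> borel_measurable \<mu>"
    unfolding field_W_def[abs_def] using f_measurable by measurable
  have W1: "avg (field_W E a x f) x = (\<Sum>e\<in>E. a e * x e * avg (f e) x)"
    unfolding field_W_def[abs_def] by (intro avg_sum f_bounded_borel)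
  \<comment> \<open>The square is written as one sum over pairs, so that linearity in the form
    \<open>avg_sum\<close> applies in a single step.\<close>
  have "(\<lambda>\<sigma>. (field_W E a x f \<sigma>)\<^sup>2) =
      (\<lambda>\<sigma>. \<Sum>p\<in>E \<times> E. (a (fst p) * x (fst p) * (a (snd p) * x (snd p))) * (f (fst p) \<sigma> * f (snd p) \<sigma>))"
    unfolding field_W_def by (simp add: power2_eq_square sum_product sum.cartesian_product mult_ac split_def)
  then have "avg (\<lambda>\<sigma>. (field_W E a x f \<sigma>)\<^sup>2) x =
      (\<Sum>p\<in>E \<times> E. (a (fst p) * x (fst p) * (a (snd p) * x (snd p))) * avg (\<lambda>\<sigma>. f (fst p) \<sigma> * f (snd p) \<sigma>) x)"
    by (subst avg_sum[symmetric]) (auto intro!: bounded_borel_mult f_bounded_borel)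
  then have W2: "avg (\<lambda>\<sigma>. (field_W E a x f \<sigma>)\<^sup>2) x =
      (\<Sum>d\<in>E. \<Sum>e\<in>E. a d * x d * (a e * x e) * avg (\<lambda>\<sigma>. f d \<sigma> * f e \<sigma>) x)"
    by (simp add: sum.cartesian_product split_def)
  have "gibbs_fluctuation E \<gamma> a x f \<mu> = avg (\<lambda>\<sigma>. (field_W E a x f \<sigma>)\<^sup>2) x - (avg (field_W E a x f) x)\<^sup>2"
    unfolding gibbs_fluctuation_def Let_def using W by (simp add: integral_gibbs_measure)
  also have "\<dots> = (\<Sum>d\<in>E. \<Sum>e\<in>E. a d * a e * (x d * x e * cov (f d) (f e) x))"
    unfolding W1 W2 cov_def by (simp add: power2_eq_square sum_product right_diff_distrib sum_subtractf mult_ac)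
  finally show ?thesis .
qed

section \<open>Integration of the covariances against the Gaussian law\<close>

lemma f_cov_bound: "d \<in> E \<Longrightarrow> e \<in> E \<Longrightarrow> \<bar>cov (f d) (f e) x\<bar> \<le> 2"
  by (intro cov_bound f_measurable f_bound)

lemma f_cov_measurable: "d \<in> E \<Longrightarrow> e \<in> E \<Longrightarrow> cov (f d) (f e) \<in> borel_measurable (\<Pi>\<^sub>M e\<in>E. borel)"
  by (intro cov_measurable f_measurable)

lemma f_cum3_bound: "d \<in> E \<Longrightarrow> e \<in> E \<Longrightarrow> i \<in> E \<Longrightarrow> \<bar>cum3 (f d) (f e) (f i) x\<bar> \<le> 6"
  by (intro cum3_bound f_measurable f_bound)

lemma f_cum3_measurable:
  "d \<in> E \<Longrightarrow> e \<in> E \<Longrightarrow> i \<in> E \<Longrightarrow> cum3 (f d) (f e) (f i) \<in> borel_measurable (\<Pi>\<^sub>M e\<in>E. borel)"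
  by (intro cum3_measurable f_measurable)

lemma integrable_cov:
  assumes "d \<in> E" "e \<in> E" "i \<in> E" "j \<in> E"
  shows "integrable (gaussian_PiM E) (cov (f d) (f e))"
    "integrable (gaussian_PiM E) (\<lambda>x. x i * x j * cov (f d) (f e) x)"
    "integrable (gaussian_PiM E) (\<lambda>x. ((x i)\<^sup>2 - 1) * cov (f d) (f e) x)"
proof -
  have "integrable (gaussian_PiM E) (\<lambda>x. 1 * cov (f d) (f e) x)"
    by (rule integrable_PiM_gaussian_quadratic[of _ _ _ 2])
       (use assms in \<open>auto intro!: f_cov_measurable f_cov_bound finite_E sum_nonneg\<close>)
  then show "integrable (gaussian_PiM E) (cov (f d) (f e))" by simp
  show "integrable (gaussian_PiM E) (\<lambda>x. x i * x j * cov (f d) (f e) x)"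
    "integrable (gaussian_PiM E) (\<lambda>x. ((x i)\<^sup>2 - 1) * cov (f d) (f e) x)"
    by (rule integrable_PiM_gaussian_quadratic[OF finite_E _ f_cov_measurable _ f_cov_bound],
        use assms in \<open>auto intro!: finite_E quadratic_bounds\<close>)+
qed

lemma integrable_cum3:
  assumes "d \<in> E" "e \<in> E" "i \<in> E" "j \<in> E"
  shows "integrable (gaussian_PiM E) (\<lambda>x. x j * cum3 (f d) (f e) (f i) x)"
  by (rule integrable_PiM_gaussian_quadratic[of _ _ _ 6])
     (use assms in \<open>auto intro!: f_cum3_measurable f_cum3_bound finite_E quadratic_bounds\<close>)

text \<open>For \<open>d = e\<close> only \<open>(x e)\<^sup>2 = 1 + ((x e)\<^sup>2 - 1)\<close> is
  used. For \<open>d \<noteq> e\<close> two integrations by parts, in different coordinates, meet in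
  the same third cumulant; the right-hand side involves only variances, which have a bound free of
  \<open>\<gamma>\<close>.\<close>

lemma gaussian_cov_ibp:
  assumes d: "d \<in> E" and e: "e \<in> E"
  shows "(\<integral>x. x d * x e * cov (f d) (f e) x \<partial>gaussian_PiM E)
    = (if d = e then \<integral>x. cov (f d) (f d) x \<partial>gaussian_PiM E else 0)
      + (\<integral>x. ((x e)\<^sup>2 - 1) * cov (f d) (f d) x \<partial>gaussian_PiM E)"
proof (cases "d = e")
  case True
  have "(\<integral>x. x d * x e * cov (f d) (f e) x \<partial>gaussian_PiM E)
      = (\<integral>x. cov (f d) (f d) x + ((x e)\<^sup>2 - 1) * cov (f d) (f d) x \<partial>gaussian_PiM E)"
    using True by (intro Bochner_Integration.integral_cong) (auto simp: power2_eq_square algebra_simps)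
  then show ?thesis
    using True d by (simp add: integrable_cov)
next
  case False
  note fb = f_bounded_borel[OF d] f_bounded_borel[OF e]
  have dist: "(x(d := t)) e = x e" "(x(e := t)) d = x d" for x t
    using False by auto
  have "(\<integral>x. x d * (x e * cov (f d) (f e) x) \<partial>gaussian_PiM E)
      = (\<integral>x. x e * (\<gamma> * cum3 (f d) (f e) (f d) x) \<partial>gaussian_PiM E)"
  proof (rule PiM_gaussian_ibp[OF finite_E d])
    fix x t
    show "((\<lambda>t. (x(d := t)) e * cov (f d) (f e) (x(d := t))) has_real_derivative
        (x(d := t)) e * (\<gamma> * cum3 (f d) (f e) (f d) (x(d := t)))) (at t)"
      unfolding dist by (intro DERIV_cmult cov_has_derivative fb d)
    show "isCont (\<lambda>t. (x(d := t)) e * (\<gamma> * cum3 (f d) (f e) (f d) (x(d := t)))) t"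
      unfolding dist by (intro continuous_intros cum3_isCont fb d)
    \<comment> \<open>Here \<open>x e\<close> is frozen while the coordinate \<open>d\<close>
      varies, so it may enter the growth constant.\<close>
    show "\<exists>K. \<forall>t. \<bar>(x(d := t)) e * cov (f d) (f e) (x(d := t))\<bar> \<le> K * (1 + \<bar>t\<bar>)"
    proof (intro exI[of _ "2 * \<bar>x e\<bar>"] allI)
      fix t
      have "\<bar>x e\<bar> * \<bar>cov (f d) (f e) (x(d := t))\<bar> \<le> \<bar>x e\<bar> * (2 * (1 + \<bar>t\<bar>))"
        using f_cov_bound[OF d e, of "x(d := t)"] by (intro mult_left_mono) auto
      then show "\<bar>(x(d := t)) e * cov (f d) (f e) (x(d := t))\<bar> \<le> 2 * \<bar>x e\<bar> * (1 + \<bar>t\<bar>)"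
        unfolding dist by (simp add: abs_mult mult_ac)
    qed
  next
    show "integrable (gaussian_PiM E) (\<lambda>x. x d * (x e * cov (f d) (f e) x))"
      using integrable_cov(2)[OF d e d e] by (simp add: mult_ac)
    show "integrable (gaussian_PiM E) (\<lambda>x. x e * (\<gamma> * cum3 (f d) (f e) (f d) x))"
      using integrable_mult_right[OF integrable_cum3[OF d e d e], of \<gamma>] by (simp add: mult_ac)
  qed
  \<comment> \<open>The function being differentiated itself contains the factor \<open>x e\<close>.
    Its derivative yields the extra \<open>cov (f d) (f d)\<close>, which becomes the -1 in
    \<open>(x e)\<^sup>2 - 1\<close>.\<close>
  moreover have "(\<integral>x. x e * (x e * cov (f d) (f d) x) \<partial>gaussian_PiM E)
      = (\<integral>x. cov (f d) (f d) x + x e * (\<gamma> * cum3 (f d) (f d) (f e) x) \<partial>gaussian_PiM E)"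
  proof (rule PiM_gaussian_ibp[OF finite_E e])
    fix x t
    show "((\<lambda>t. (x(e := t)) e * cov (f d) (f d) (x(e := t))) has_real_derivative
        cov (f d) (f d) (x(e := t)) + (x(e := t)) e * (\<gamma> * cum3 (f d) (f d) (f e) (x(e := t)))) (at t)"
      unfolding fun_upd_same
      by (rule DERIV_cong[OF DERIV_mult[OF DERIV_ident cov_has_derivative[OF fb(1) fb(1) e]]])
         (simp add: mult_ac)
    show "isCont (\<lambda>t. cov (f d) (f d) (x(e := t)) + (x(e := t)) e * (\<gamma> * cum3 (f d) (f d) (f e) (x(e := t)))) t"
      unfolding fun_upd_same
      by (intro continuous_intros cum3_isCont DERIV_isCont[OF cov_has_derivative] fb e)
    show "\<exists>K. \<forall>t. \<bar>(x(e := t)) e * cov (f d) (f d) (x(e := t))\<bar> \<le> K * (1 + \<bar>t\<bar>)"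
    proof (intro exI[of _ 2] allI)
      fix t
      have "\<bar>t\<bar> * \<bar>cov (f d) (f d) (x(e := t))\<bar> \<le> (1 + \<bar>t\<bar>) * 2"
        using f_cov_bound[OF d d, of "x(e := t)"] by (intro mult_mono) auto
      then show "\<bar>(x(e := t)) e * cov (f d) (f d) (x(e := t))\<bar> \<le> 2 * (1 + \<bar>t\<bar>)"
        by (simp add: abs_mult mult_ac)
    qed
  next
    show "integrable (gaussian_PiM E) (\<lambda>x. x e * (x e * cov (f d) (f d) x))"
      using integrable_cov(2)[OF d d e e] by (simp add: mult_ac)
    show "integrable (gaussian_PiM E) (\<lambda>x. cov (f d) (f d) x + x e * (\<gamma> * cum3 (f d) (f d) (f e) x))"
      using integrable_cov(1)[OF d d e e] integrable_mult_right[OF integrable_cum3[OF d d e e], of \<gamma>]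
      by (simp add: mult_ac)
  qed
  moreover have "(\<integral>x. ((x e)\<^sup>2 - 1) * cov (f d) (f d) x \<partial>gaussian_PiM E)
      = (\<integral>x. x e * (x e * cov (f d) (f d) x) \<partial>gaussian_PiM E) - (\<integral>x. cov (f d) (f d) x \<partial>gaussian_PiM E)"
    using integrable_cov(2)[OF d d e e] integrable_cov(1)[OF d d e e]
    by (subst Bochner_Integration.integral_diff[symmetric])
       (auto simp: power2_eq_square mult_ac left_diff_distrib)
  moreover have "(\<integral>x. cov (f d) (f d) x + x e * (\<gamma> * cum3 (f d) (f d) (f e) x) \<partial>gaussian_PiM E)
      = (\<integral>x. cov (f d) (f d) x \<partial>gaussian_PiM E) + (\<integral>x. x e * (\<gamma> * cum3 (f d) (f d) (f e) x) \<partial>gaussian_PiM E)"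
    using integrable_cov(1)[OF d d e e] integrable_mult_right[OF integrable_cum3[OF d d e e], of \<gamma>]
    by (intro Bochner_Integration.integral_add) (auto simp: mult_ac)
  ultimately show ?thesis
    using False by (simp add: cum3_commute[of "f d" "f e"] mult.assoc)
qed

text \<open>The constant depends only on \<open>a\<close> and \<open>E\<close>, not on
  \<open>f\<close> or \<open>\<mu>\<close>, so the same dominating function works for all
  realizations of the disorder.\<close>

lemma gibbs_fluctuation_bound:
  "\<bar>gibbs_fluctuation E \<gamma> a x f \<mu>\<bar> \<le> (\<Sum>d\<in>E. \<Sum>e\<in>E. 2 * \<bar>a d * a e\<bar>) * (1 + (\<Sum>e\<in>E. (x e)\<^sup>2))"
  unfolding gibbs_fluctuation_eq sum_distrib_right
proof (intro order_trans[OF sum_abs] sum_mono)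
  fix d e assume de: "d \<in> E" "e \<in> E"
  have "\<bar>x d * x e\<bar> * \<bar>cov (f d) (f e) x\<bar> \<le> (1 + (\<Sum>e\<in>E. (x e)\<^sup>2)) * 2"
    using de by (intro mult_mono quadratic_bounds f_cov_bound finite_E)
      (auto intro!: add_nonneg_nonneg sum_nonneg)
  then have "\<bar>a d * a e\<bar> * (\<bar>x d * x e\<bar> * \<bar>cov (f d) (f e) x\<bar>)
      \<le> \<bar>a d * a e\<bar> * ((1 + (\<Sum>e\<in>E. (x e)\<^sup>2)) * 2)"
    by (rule mult_left_mono) simp
  then show "\<bar>a d * a e * (x d * x e * cov (f d) (f e) x)\<bar> \<le> 2 * \<bar>a d * a e\<bar> * (1 + (\<Sum>e\<in>E. (x e)\<^sup>2))"
    by (simp add: abs_mult mult_ac)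
qed

lemma integral_gibbs_fluctuation_le:
  "(\<integral>x. gibbs_fluctuation E \<gamma> a x f \<mu> \<partial>gaussian_PiM E)
    \<le> (L2_set a E)\<^sup>2 + sqrt 2 * L2_set a E * (\<Sum>e\<in>E. \<bar>a e\<bar>)"
proof -
  interpret P: prob_space "gaussian_PiM E"
    by (intro prob_space_PiM prob_space_std_gaussian)
  \<comment> \<open>The sum over \<open>e\<close> is gathered into one variable, the same for every
    \<open>d\<close>, before absolute values are taken. Hence this sum costs the 2-norm of
    \<open>a\<close>; only the remaining sum over \<open>d\<close> costs the 1-norm.\<close>
  define X where "X = (\<lambda>x. \<Sum>e\<in>E. a e * ((x e)\<^sup>2 - 1))"
  have X_int: "integrable (gaussian_PiM E) X"
    using PiM_gaussian_chisq_L1(1)[OF finite_E, of a] by (simp add: X_def)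
  have C: "\<bar>cov (f d) (f d) x\<bar> \<le> 1" if "d \<in> E" for d x
    by (intro var_bound f_measurable f_bound that)
  have CX_int: "integrable (gaussian_PiM E) (\<lambda>x. X x * cov (f d) (f d) x)" if "d \<in> E" for d
  proof -
    have "integrable (gaussian_PiM E) (\<lambda>x. \<Sum>e\<in>E. a e * (((x e)\<^sup>2 - 1) * cov (f d) (f d) x))"
      using that by (intro Bochner_Integration.integrable_sum integrable_mult_right integrable_cov)
    then show ?thesis by (simp add: X_def sum_distrib_right mult.assoc)
  qed
  have "(\<integral>x. gibbs_fluctuation E \<gamma> a x f \<mu> \<partial>gaussian_PiM E)
      = (\<Sum>d\<in>E. \<Sum>e\<in>E. a d * a e * (\<integral>x. x d * x e * cov (f d) (f e) x \<partial>gaussian_PiM E))"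
    unfolding gibbs_fluctuation_eq by (simp add: integrable_cov Bochner_Integration.integral_sum)
  also have "\<dots> = (\<Sum>d\<in>E. (a d)\<^sup>2 * (\<integral>x. cov (f d) (f d) x \<partial>gaussian_PiM E)
      + a d * (\<integral>x. X x * cov (f d) (f d) x \<partial>gaussian_PiM E))"
  proof (rule sum.cong[OF refl])
    fix d assume d: "d \<in> E"
    have "(\<integral>x. X x * cov (f d) (f d) x \<partial>gaussian_PiM E)
        = (\<Sum>e\<in>E. a e * (\<integral>x. ((x e)\<^sup>2 - 1) * cov (f d) (f d) x \<partial>gaussian_PiM E))"
      using d by (simp add: X_def sum_distrib_right mult.assoc integrable_cov Bochner_Integration.integral_sum)
    moreover have "(\<Sum>e\<in>E. a d * a e * (if d = e then c else 0)) = (a d)\<^sup>2 * c" for c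
      using d finite_E by (simp add: if_distrib sum.delta power2_eq_square cong: if_cong)
    moreover have "(\<Sum>e\<in>E. a d * a e * (\<integral>x. x d * x e * cov (f d) (f e) x \<partial>gaussian_PiM E))
        = (\<Sum>e\<in>E. a d * a e * (if d = e then \<integral>x. cov (f d) (f d) x \<partial>gaussian_PiM E else 0)
          + a d * (a e * (\<integral>x. ((x e)\<^sup>2 - 1) * cov (f d) (f d) x \<partial>gaussian_PiM E)))"
      by (intro sum.cong refl) (simp add: gaussian_cov_ibp[OF d] distrib_left del: mult.assoc)
    ultimately show "(\<Sum>e\<in>E. a d * a e * (\<integral>x. x d * x e * cov (f d) (f e) x \<partial>gaussian_PiM E))
        = (a d)\<^sup>2 * (\<integral>x. cov (f d) (f d) x \<partial>gaussian_PiM E)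
          + a d * (\<integral>x. X x * cov (f d) (f d) x \<partial>gaussian_PiM E)"
      by (simp only: sum.distrib sum_distrib_left)
  qed
  also have "\<dots> \<le> (\<Sum>d\<in>E. (a d)\<^sup>2 + \<bar>a d\<bar> * (sqrt 2 * L2_set a E))"
  proof (intro sum_mono add_mono)
    fix d assume d: "d \<in> E"
    have "(\<integral>x. cov (f d) (f d) x \<partial>gaussian_PiM E) \<le> 1"
      using C[OF d] d by (intro P.integral_le_const integrable_cov) (auto simp: abs_le_iff)
    then show "(a d)\<^sup>2 * (\<integral>x. cov (f d) (f d) x \<partial>gaussian_PiM E) \<le> (a d)\<^sup>2"
      by (intro mult_left_le) auto
    \<comment> \<open>By \<open>var_bound\<close> the variance factor is at most 1 in absolute
      value, which leaves the L1 norm of \<open>X\<close>.\<close>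
    have "\<bar>\<integral>x. X x * cov (f d) (f d) x \<partial>gaussian_PiM E\<bar> \<le> (\<integral>x. \<bar>X x\<bar> \<partial>gaussian_PiM E)"
      by (rule order_trans[OF integral_abs_bound], intro integral_mono integrable_abs CX_int X_int d)
         (auto simp: abs_mult intro!: mult_left_le C d)
    also have "\<dots> \<le> sqrt 2 * L2_set a E"
      using PiM_gaussian_chisq_L1(2)[OF finite_E, of a] by (simp add: X_def)
    finally have "\<bar>a d * (\<integral>x. X x * cov (f d) (f d) x \<partial>gaussian_PiM E)\<bar> \<le> \<bar>a d\<bar> * (sqrt 2 * L2_set a E)"
      unfolding abs_mult by (rule mult_left_mono) simp
    then show "a d * (\<integral>x. X x * cov (f d) (f d) x \<partial>gaussian_PiM E) \<le> \<bar>a d\<bar> * (sqrt 2 * L2_set a E)"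
      by linarith
  qed
  also have "\<dots> = (L2_set a E)\<^sup>2 + sqrt 2 * L2_set a E * (\<Sum>e\<in>E. \<bar>a e\<bar>)"
    by (simp add: L2_set_def sum.distrib sum_nonneg mult.commute sum_distrib_right)
  finally show ?thesis .
qed

end

section \<open>Random disorder\<close>

text \<open>Normalising to a sub-probability kernel reduces this to the Giry monad.\<close>

lemma random_finite_measure_nn_integral:
  assumes rfm: "random_finite_measure H S \<mu>" and F: "F \<in> borel_measurable (H \<Otimes>\<^sub>M S)"
  shows "(\<lambda>\<omega>. \<integral>\<^sup>+\<sigma>. F (\<omega>, \<sigma>) \<partial>\<mu> \<omega>) \<in> borel_measurable H"
\<comment> \<open>A sub-probability space must be nonempty, so the empty case is split off.\<close>
proof (cases "space S = {}")
  case True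
  have "(\<integral>\<^sup>+\<sigma>. F (\<omega>, \<sigma>) \<partial>\<mu> \<omega>) = 0" if "\<omega> \<in> space H" for \<omega>
  proof -
    have "space (\<mu> \<omega>) = {}"
      using rfm that True by (auto simp: random_finite_measure_def dest: sets_eq_imp_space_eq)
    then show ?thesis by (rule nn_integral_empty)
  qed
  then show ?thesis by (simp cong: measurable_cong)
next
  case False
  define m where "m \<omega> = emeasure (\<mu> \<omega>) (space S)" for \<omega>
  define \<nu> where "\<nu> \<omega> = scale_measure (inverse (m \<omega>)) (\<mu> \<omega>)" for \<omega>
  have sets: "sets (\<mu> \<omega>) = sets S" "space (\<mu> \<omega>) = space S" and fin: "m \<omega> \<noteq> \<infinity>" if "\<omega> \<in> space H" for \<omega>
  proof -
    show "sets (\<mu> \<omega>) = sets S" using rfm that by (simp add: random_finite_measure_def)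
    then show sp: "space (\<mu> \<omega>) = space S" by (rule sets_eq_imp_space_eq)
    have "finite_measure (\<mu> \<omega>)" using rfm that by (simp add: random_finite_measure_def)
    from finite_measure.emeasure_finite[OF this] show "m \<omega> \<noteq> \<infinity>" by (simp add: m_def)
  qed
  have [measurable]: "m \<in> borel_measurable H"
    using rfm by (simp add: m_def[abs_def] random_finite_measure_def)
  have \<nu>: "\<nu> \<in> measurable H (subprob_algebra S)"
  proof (rule measurable_subprob_algebra)
    fix \<omega> assume \<omega>: "\<omega> \<in> space H"
    show "sets (\<nu> \<omega>) = sets S" using sets[OF \<omega>] by (simp add: \<nu>_def)
    show "subprob_space (\<nu> \<omega>)"
    proof
      \<comment> \<open>If the mass is 0, its inverse is infinite, but the product is 0 in
        \<open>ennreal\<close>, so the bound still holds.\<close>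
      have "inverse (m \<omega>) * m \<omega> \<le> 1"
        using fin[OF \<omega>] by (cases "m \<omega> = 0") (auto simp: ennreal_divide_self divide_ennreal_def[symmetric] mult.commute less_top)
      then show "emeasure (\<nu> \<omega>) (space (\<nu> \<omega>)) \<le> 1"
        using sets[OF \<omega>] by (simp add: \<nu>_def space_scale_measure m_def)
      show "space (\<nu> \<omega>) \<noteq> {}" using sets[OF \<omega>] False by (simp add: \<nu>_def space_scale_measure)
    qed
  next
    fix A assume "A \<in> sets S"
    then have [measurable]: "(\<lambda>\<omega>. emeasure (\<mu> \<omega>) A) \<in> borel_measurable H"
      using rfm by (simp add: random_finite_measure_def)
    show "(\<lambda>\<omega>. emeasure (\<nu> \<omega>) A) \<in> borel_measurable H"
      unfolding \<nu>_def emeasure_scale_measure by measurable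
  qed
  have "(\<lambda>\<omega>. \<integral>\<^sup>+\<sigma>. F (\<omega>, \<sigma>) \<partial>\<nu> \<omega>) \<in> borel_measurable H"
    by (rule nn_integral_measurable_subprob_algebra2[OF _ \<nu>]) (use F in simp)
  then have "(\<lambda>\<omega>. m \<omega> * (\<integral>\<^sup>+\<sigma>. F (\<omega>, \<sigma>) \<partial>\<nu> \<omega>)) \<in> borel_measurable H"
    by measurable
  moreover have "m \<omega> * (\<integral>\<^sup>+\<sigma>. F (\<omega>, \<sigma>) \<partial>\<nu> \<omega>) = (\<integral>\<^sup>+\<sigma>. F (\<omega>, \<sigma>) \<partial>\<mu> \<omega>)" if \<omega>: "\<omega> \<in> space H" for \<omega>
  proof -
    have Fm: "(\<lambda>\<sigma>. F (\<omega>, \<sigma>)) \<in> borel_measurable (\<mu> \<omega>)"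
      using measurable_Pair2[OF F \<omega>] sets(1)[OF \<omega>] by (simp cong: measurable_cong_sets)
    then have eq: "(\<integral>\<^sup>+\<sigma>. F (\<omega>, \<sigma>) \<partial>\<nu> \<omega>) = inverse (m \<omega>) * (\<integral>\<^sup>+\<sigma>. F (\<omega>, \<sigma>) \<partial>\<mu> \<omega>)"
      unfolding \<nu>_def by (rule nn_integral_scale_measure)
    show ?thesis
    proof (cases "m \<omega> = 0")
      case True
      then have "AE \<sigma> in \<mu> \<omega>. False"
        using sets(2)[OF \<omega>] by (auto simp: AE_iff_measurable[OF sets.top] m_def)
      then have "(\<integral>\<^sup>+\<sigma>. F (\<omega>, \<sigma>) \<partial>\<mu> \<omega>) = (\<integral>\<^sup>+\<sigma>. 0 \<partial>\<mu> \<omega>)"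
        by (intro nn_integral_cong_AE) auto
      with True show ?thesis by simp
    next
      case False
      then have "m \<omega> * inverse (m \<omega>) = 1"
        using fin[OF \<omega>] by (simp add: divide_ennreal_def[symmetric] less_top)
      then show ?thesis by (simp add: eq mult.assoc[symmetric])
    qed
  qed
  ultimately show ?thesis by (simp cong: measurable_cong)
qed

text \<open>The integral is the difference of those of the positive and negative parts, since
  \<open>ennreal\<close> sends negative numbers to 0. Integrability makes this formula valid for
  each realization.\<close>

lemma random_finite_measure_integral:
  fixes F :: "_ \<Rightarrow> real"
  assumes rfm: "random_finite_measure H S \<mu>" and F [measurable]: "F \<in> borel_measurable (H \<Otimes>\<^sub>M S)"
    and int: "\<And>\<omega>. \<omega> \<in> space H \<Longrightarrow> integrable (\<mu> \<omega>) (\<lambda>\<sigma>. F (\<omega>, \<sigma>))"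
  shows "(\<lambda>\<omega>. \<integral>\<sigma>. F (\<omega>, \<sigma>) \<partial>\<mu> \<omega>) \<in> borel_measurable H"
proof -
  have [measurable]: "(\<lambda>\<omega>. \<integral>\<^sup>+\<sigma>. ennreal (F (\<omega>, \<sigma>)) \<partial>\<mu> \<omega>) \<in> borel_measurable H"
    "(\<lambda>\<omega>. \<integral>\<^sup>+\<sigma>. ennreal (- F (\<omega>, \<sigma>)) \<partial>\<mu> \<omega>) \<in> borel_measurable H"
    using random_finite_measure_nn_integral[OF rfm, of "\<lambda>p. ennreal (F p)"]
      random_finite_measure_nn_integral[OF rfm, of "\<lambda>p. ennreal (- F p)"] by simp_all
  have "(\<lambda>\<omega>. enn2real (\<integral>\<^sup>+\<sigma>. ennreal (F (\<omega>, \<sigma>)) \<partial>\<mu> \<omega>) - enn2real (\<integral>\<^sup>+\<sigma>. ennreal (- F (\<omega>, \<sigma>)) \<partial>\<mu> \<omega>))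
      \<in> borel_measurable H"
    by measurable
  then show ?thesis
    by (rule measurable_cong[THEN iffD1, rotated]) (simp add: real_lebesgue_integral_def int)
qed

text \<open>The Gaussian vector is adjoined to the parameter of the random measure, as needed for
  joint measurability.\<close>

lemma random_finite_measure_fst:
  assumes "random_finite_measure H S \<mu>"
  shows "random_finite_measure (H \<Otimes>\<^sub>M P) S (\<lambda>p. \<mu> (fst p))"
  using assms unfolding random_finite_measure_def
  by (auto simp: space_pair_measure intro: measurable_compose[OF measurable_fst])

text \<open>Fubini's theorem needs measurability jointly in the disorder and the Gaussian vector.
  The covariance formula reduces it to finitely many integrals against \<open>\<mu>\<close>.\<close>

lemma gibbs_fluctuation_measurable:
  fixes f :: "'e \<Rightarrow> 'w \<Rightarrow> 's \<Rightarrow> real" and \<mu> :: "'w \<Rightarrow> 's measure"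
  assumes E: "finite E"
    and f_meas: "\<And>e. e \<in> E \<Longrightarrow> (\<lambda>(\<omega>, \<sigma>). f e \<omega> \<sigma>) \<in> borel_measurable (H \<Otimes>\<^sub>M S)"
    and gibbs: "\<And>\<omega>. \<omega> \<in> space H \<Longrightarrow> gibbs_system (\<mu> \<omega>) E (\<lambda>e. f e \<omega>)"
    and mu: "random_finite_measure H S \<mu>"
  shows "(\<lambda>(\<omega>, x). gibbs_fluctuation E \<gamma> a x (\<lambda>e. f e \<omega>) (\<mu> \<omega>))
    \<in> borel_measurable (H \<Otimes>\<^sub>M (\<Pi>\<^sub>M e\<in>E. borel))"
proof -
  let ?K = "H \<Otimes>\<^sub>M (\<Pi>\<^sub>M e\<in>E. borel :: real measure)"
  \<comment> \<open>This is \<open>weighted\<close> with the realization of the disorder as a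
    further variable.\<close>
  define N where "N h p = (\<integral>\<sigma>. h (fst p) \<sigma> * exp (\<gamma> * field_Y E (snd p) (\<lambda>e. f e (fst p)) \<sigma>) \<partial>\<mu> (fst p))"
    for h and p :: "'w \<times> ('e \<Rightarrow> real)"
  have N: "N h \<in> borel_measurable ?K"
    if h: "(\<lambda>(\<omega>, \<sigma>). h \<omega> \<sigma>) \<in> borel_measurable (H \<Otimes>\<^sub>M S)"
      and hb: "\<And>\<omega>. \<omega> \<in> space H \<Longrightarrow> h \<omega> \<in> bounded_borel (\<mu> \<omega>)" for h
  proof -
    have lift: "(\<lambda>q. k (fst (fst q)) (snd q)) \<in> borel_measurable (?K \<Otimes>\<^sub>M S)"
      if "(\<lambda>(\<omega>, \<sigma>). k \<omega> \<sigma>) \<in> borel_measurable (H \<Otimes>\<^sub>M S)" for k :: "'w \<Rightarrow> 's \<Rightarrow> real"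
      using measurable_compose[OF _ that, of "\<lambda>q. (fst (fst q), snd q)" "?K \<Otimes>\<^sub>M S"] by simp
    have [measurable]: "(\<lambda>q. h (fst (fst q)) (snd q)) \<in> borel_measurable (?K \<Otimes>\<^sub>M S)"
      by (rule lift[OF h])
    have [measurable]: "(\<lambda>q. f e (fst (fst q)) (snd q)) \<in> borel_measurable (?K \<Otimes>\<^sub>M S)" if "e \<in> E" for e
      by (rule lift[OF f_meas[OF that]])
    show ?thesis
      unfolding N_def
    proof (rule random_finite_measure_integral[OF random_finite_measure_fst[OF mu],
          where F = "\<lambda>q. h (fst (fst q)) (snd q) * exp (\<gamma> * field_Y E (snd (fst q)) (\<lambda>e. f e (fst (fst q))) (snd q))",
          simplified fst_conv snd_conv])
      show "(\<lambda>q. h (fst (fst q)) (snd q) * exp (\<gamma> * field_Y E (snd (fst q)) (\<lambda>e. f e (fst (fst q))) (snd q)))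
          \<in> borel_measurable (?K \<Otimes>\<^sub>M S)"
        unfolding field_Y_def by measurable
      fix p assume "p \<in> space ?K"
      then have p: "fst p \<in> space H" by (auto simp: space_pair_measure)
      interpret gibbs_system "\<mu> (fst p)" E "\<lambda>e. f e (fst p)" \<gamma> by (rule gibbs[OF p])
      show "integrable (\<mu> (fst p)) (\<lambda>\<sigma>. h (fst p) \<sigma> * exp (\<gamma> * field_Y E (snd p) (\<lambda>e. f e (fst p)) \<sigma>))"
        by (rule integrable_weighted[OF hb[OF p]])
    qed
  qed
  have f_bb: "f e \<omega> \<in> bounded_borel (\<mu> \<omega>)" if "e \<in> E" "\<omega> \<in> space H" for e \<omega>
    using gibbs_system.f_bounded_borel[OF gibbs[OF that(2)] that(1)] .
  have [measurable]: "N (\<lambda>_ _. 1) \<in> borel_measurable ?K"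
    by (intro N) auto
  have [measurable]: "N (f e) \<in> borel_measurable ?K" if "e \<in> E" for e
    using that by (intro N f_meas f_bb)
  have [measurable]: "N (\<lambda>\<omega> \<sigma>. f d \<omega> \<sigma> * f e \<omega> \<sigma>) \<in> borel_measurable ?K" if "d \<in> E" "e \<in> E" for d e
  proof (intro N bounded_borel_mult f_bb that)
    show "(\<lambda>(\<omega>, \<sigma>). f d \<omega> \<sigma> * f e \<omega> \<sigma>) \<in> borel_measurable (H \<Otimes>\<^sub>M S)"
      using borel_measurable_times[OF f_meas[OF that(1)] f_meas[OF that(2)]] by (simp add: split_def)
  qed
  have "(\<lambda>p. \<Sum>d\<in>E. \<Sum>e\<in>E. a d * a e * (snd p d * snd p e *
      (N (\<lambda>\<omega> \<sigma>. f d \<omega> \<sigma> * f e \<omega> \<sigma>) p / N (\<lambda>_ _. 1) p - N (f d) p / N (\<lambda>_ _. 1) p * (N (f e) p / N (\<lambda>_ _. 1) p))))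
      \<in> borel_measurable ?K"
    by measurable
  then show ?thesis
  proof (rule measurable_cong[THEN iffD1, rotated])
    fix p assume "p \<in> space ?K"
    then have p: "fst p \<in> space H" by (auto simp: space_pair_measure)
    interpret gibbs_system "\<mu> (fst p)" E "\<lambda>e. f e (fst p)" \<gamma> by (rule gibbs[OF p])
    show "(\<Sum>d\<in>E. \<Sum>e\<in>E. a d * a e * (snd p d * snd p e *
      (N (\<lambda>\<omega> \<sigma>. f d \<omega> \<sigma> * f e \<omega> \<sigma>) p / N (\<lambda>_ _. 1) p - N (f d) p / N (\<lambda>_ _. 1) p * (N (f e) p / N (\<lambda>_ _. 1) p))))
      = (case p of (\<omega>, x) \<Rightarrow> gibbs_fluctuation E \<gamma> a x (\<lambda>e. f e \<omega>) (\<mu> \<omega>))"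
      by (simp add: split_def gibbs_fluctuation_eq cov_def avg_def weighted_def N_def)
  qed
qed

section \<open>Joint law of the disorder and the Gaussian vector\<close>

lemma (in prob_space) distr_iid_std_normal:
  assumes "\<And>e. e \<in> E \<Longrightarrow> distributed M lborel (g e) std_normal_density"
    and "indep_vars (\<lambda>_. borel) g E"
  shows "distr M (\<Pi>\<^sub>M e\<in>E. borel) (\<lambda>\<omega>. \<lambda>e\<in>E. g e \<omega>) = gaussian_PiM E"
proof -
  have rv: "random_variable borel (g e)" if "e \<in> E" for e
    using distributed_measurable[OF assms(1)[OF that]] by simp
  have d: "distr M borel (g e) = std_gaussian" if "e \<in> E" for e
    using distributed_distr_eq_density[OF assms(1)[OF that]] by (simp cong: distr_cong)
  show ?thesis
  \<comment> \<open>The description of independence by a product law is applied to nonempty index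
    sets. For empty \<open>E\<close> both laws are the point mass at the undefined function.\<close>
  proof (cases "E = {}")
    case True
    have "emeasure (distr M (\<Pi>\<^sub>M e\<in>{}. borel :: real measure) (\<lambda>\<omega>. \<lambda>e\<in>{}. g e \<omega>)) {\<lambda>_. undefined} = 1"
      by (subst emeasure_distr) (auto simp: space_PiM emeasure_space_1 PiE_empty_domain restrict_def
          sets_PiM_empty vimage_def)
    then show ?thesis
      using True by (intro measure_eqI) (auto simp: PiM_empty subset_singleton_iff)
  next
    case False
    then have "distr M (\<Pi>\<^sub>M e\<in>E. borel) (\<lambda>\<omega>. \<lambda>e\<in>E. g e \<omega>) = (\<Pi>\<^sub>M e\<in>E. distr M borel (g e))"
      using indep_vars_iff_distr_eq_PiM'[where I = E and M' = "\<lambda>_. borel" and X = g] rv assms(2) by simp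
    also have "\<dots> = gaussian_PiM E"
      by (intro PiM_cong refl d)
    finally show ?thesis .
  qed
qed

text \<open>The disorder is represented by the identity map into the coarser space \<open>H\<close>,
  so no separate random variable has to generate it. On rectangles the product formula is the
  independence hypothesis.\<close>

lemma (in prob_space) distr_pair_indep_subalgebra:
  assumes H: "subalgebra M H" and X: "random_variable N X"
    and indep: "indep_set (sets H) (sets (vimage_algebra (space M) X N))"
  shows "distr M H (\<lambda>\<omega>. \<omega>) \<Otimes>\<^sub>M distr M N X = distr M (H \<Otimes>\<^sub>M N) (\<lambda>\<omega>. (\<omega>, X \<omega>))"
proof -
  have sp: "space H = space M" and sub: "sets H \<subseteq> sets M"
    using H by (auto simp: subalgebra_def)
  have id: "random_variable H (\<lambda>\<omega>. \<omega>)"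
    using sub sp by (auto intro!: measurableI dest: sets.sets_into_space simp: Int_absorb2)
  interpret D: prob_space "distr M H (\<lambda>\<omega>. \<omega>)" by (rule prob_space_distr[OF id])
  interpret DX: prob_space "distr M N X" by (rule prob_space_distr[OF X])
  have pair: "(\<lambda>\<omega>. (\<omega>, X \<omega>)) \<in> measurable M (H \<Otimes>\<^sub>M N)"
    by (intro measurable_Pair id X)
  show ?thesis
  proof (rule pair_measure_eqI[OF D.sigma_finite_measure_axioms DX.sigma_finite_measure_axioms])
    show "sets (distr M H (\<lambda>\<omega>. \<omega>) \<Otimes>\<^sub>M distr M N X) = sets (distr M (H \<Otimes>\<^sub>M N) (\<lambda>\<omega>. (\<omega>, X \<omega>)))"
      unfolding sets_distr by (intro sets_pair_measure_cong sets_distr)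
    fix A B assume "A \<in> sets (distr M H (\<lambda>\<omega>. \<omega>))" "B \<in> sets (distr M N X)"
    then have A: "A \<in> sets H" and B: "B \<in> sets N" by auto
    have "A \<inter> space M = A" using sets.sets_into_space[OF A] sp by auto
    moreover have "(\<lambda>\<omega>. (\<omega>, X \<omega>)) -` (A \<times> B) \<inter> space M = A \<inter> (X -` B \<inter> space M)"
      using calculation by auto
    moreover have "prob (A \<inter> (X -` B \<inter> space M)) = prob A * prob (X -` B \<inter> space M)"
      by (rule indep_setD[OF indep A in_vimage_algebra[OF B]])
    ultimately show "emeasure (distr M H (\<lambda>\<omega>. \<omega>)) A * emeasure (distr M N X) B
        = emeasure (distr M (H \<Otimes>\<^sub>M N) (\<lambda>\<omega>. (\<omega>, X \<omega>))) (A \<times> B)"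
      using A B by (simp add: emeasure_distr[OF id] emeasure_distr[OF X] emeasure_distr[OF pair]
          emeasure_eq_measure ennreal_mult)
  qed
qed

text \<open>All randomness of \<open>f\<close> and \<open>\<mu>\<close> is expressed by
  measurability with respect to \<open>H\<close>. Integrability is part of the conclusion, so that
  the expectation is a genuine integral and not the default value 0.\<close>

theorem theorem5:
  fixes M :: "'w measure"
    and H :: "'w measure"
    and S :: "'s measure"
    and E :: "'e set"
    and f :: "'e \<Rightarrow> 'w \<Rightarrow> 's \<Rightarrow> real"
    and g :: "'e \<Rightarrow> 'w \<Rightarrow> real"
    and \<mu> :: "'w \<Rightarrow> 's measure"
    and \<gamma> :: real
    and a :: "'e \<Rightarrow> real"
  assumes M: "prob_space M"
    and E: "finite E"
    and g_normal: "\<And>e. e \<in> E \<Longrightarrow> distributed M lborel (g e) std_normal_density"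
    and g_indep: "prob_space.indep_vars M (\<lambda>_. borel) g E"
    and H: "subalgebra M H"
    and H_indep: "prob_space.indep_set M (sets H)
          (sets (vimage_algebra (space M) (\<lambda>\<omega>. \<lambda>e\<in>E. g e \<omega>) (\<Pi>\<^sub>M e\<in>E. borel)))"
    and f_meas: "\<And>e. e \<in> E \<Longrightarrow> (\<lambda>(\<omega>, \<sigma>). f e \<omega> \<sigma>) \<in> borel_measurable (H \<Otimes>\<^sub>M S)"
    and f_range: "\<And>e \<omega> \<sigma>. e \<in> E \<Longrightarrow> \<omega> \<in> space M \<Longrightarrow> \<sigma> \<in> space S \<Longrightarrow> f e \<omega> \<sigma> \<in> {-1..1}"
    and mu: "random_finite_measure H S \<mu>"
    and mu_nonzero: "\<And>\<omega>. \<omega> \<in> space M \<Longrightarrow> emeasure (\<mu> \<omega>) (space S) \<noteq> 0"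
    and gamma: "\<gamma> > 0"
  shows "integrable M
           (\<lambda>\<omega>. gibbs_fluctuation E \<gamma> a (\<lambda>e. g e \<omega>) (\<lambda>e. f e \<omega>) (\<mu> \<omega>)) \<and>
         prob_space.expectation M
           (\<lambda>\<omega>. gibbs_fluctuation E \<gamma> a (\<lambda>e. g e \<omega>) (\<lambda>e. f e \<omega>) (\<mu> \<omega>))
         \<le> (L2_set a E)\<^sup>2 + sqrt 2 * L2_set a E * (\<Sum>e\<in>E. \<bar>a e\<bar>)"
proof -
  interpret prob_space M by (rule M)
  define X where "X = (\<lambda>\<omega>. \<lambda>e\<in>E. g e \<omega>)"
  define B where "B = (L2_set a E)\<^sup>2 + sqrt 2 * L2_set a E * (\<Sum>e\<in>E. \<bar>a e\<bar>)"
  define \<Phi> where "\<Phi> = (\<lambda>(\<omega>, x). gibbs_fluctuation E \<gamma> a x (\<lambda>e. f e \<omega>) (\<mu> \<omega>))"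
  define K where "K = (\<Sum>d\<in>E. \<Sum>e\<in>E. 2 * \<bar>a d * a e\<bar>)"
  let ?D = "distr M H (\<lambda>\<omega>. \<omega>)" and ?G = "gaussian_PiM E"
  have sp: "space H = space M" using H by (simp add: subalgebra_def)
  have id: "(\<lambda>\<omega>. \<omega>) \<in> measurable M H"
    using H by (auto simp: subalgebra_def intro!: measurableI dest: sets.sets_into_space)
  have g_rv: "random_variable borel (g e)" if "e \<in> E" for e
    using distributed_measurable[OF g_normal[OF that]] by simp
  have X_rv: "random_variable (\<Pi>\<^sub>M e\<in>E. borel) X"
    unfolding X_def by (intro measurable_restrict g_rv)
  have X_distr: "distr M (\<Pi>\<^sub>M e\<in>E. borel) X = ?G"
    unfolding X_def by (rule distr_iid_std_normal[OF g_normal g_indep])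
  have joint: "distr M (H \<Otimes>\<^sub>M (\<Pi>\<^sub>M e\<in>E. borel)) (\<lambda>\<omega>. (\<omega>, X \<omega>)) = ?D \<Otimes>\<^sub>M ?G"
    using distr_pair_indep_subalgebra[OF H X_rv] H_indep unfolding X_distr by (simp add: X_def)
  have gibbs: "gibbs_system (\<mu> \<omega>) E (\<lambda>e. f e \<omega>)" if "\<omega> \<in> space M" for \<omega>
  proof -
    have sets: "sets (\<mu> \<omega>) = sets S" and fin: "finite_measure (\<mu> \<omega>)"
      using mu that sp by (auto simp: random_finite_measure_def)
    have space: "space (\<mu> \<omega>) = space S" by (rule sets_eq_imp_space_eq[OF sets])
    interpret finite_measure "\<mu> \<omega>" by (rule fin)
    show ?thesis
    proof
      show "f e \<omega> \<in> borel_measurable (\<mu> \<omega>)" if "e \<in> E" for e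
        using measurable_Pair2[OF f_meas[OF that], of \<omega>] \<open>\<omega> \<in> space M\<close> sp sets
        by (simp cong: measurable_cong_sets)
      show "\<bar>f e \<omega> \<sigma>\<bar> \<le> 1" if "e \<in> E" "\<sigma> \<in> space (\<mu> \<omega>)" for e \<sigma>
        using f_range[OF that(1) \<open>\<omega> \<in> space M\<close>] that(2) space by (auto simp: abs_le_iff)
    qed (use E mu_nonzero[OF that] space in auto)
  qed
  have \<Phi>_meas: "\<Phi> \<in> borel_measurable (H \<Otimes>\<^sub>M (\<Pi>\<^sub>M e\<in>E. borel))"
    unfolding \<Phi>_def by (rule gibbs_fluctuation_measurable[OF E f_meas gibbs mu]) (auto simp: sp)
  have XG: "(\<lambda>\<omega>. (\<omega>, X \<omega>)) \<in> measurable M (H \<Otimes>\<^sub>M (\<Pi>\<^sub>M e\<in>E. borel))"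
    by (intro measurable_Pair id X_rv)
  \<comment> \<open>The vector \<open>X \<omega>\<close> agrees with \<open>g\<close> on
    \<open>E\<close> and is undefined elsewhere; the fields see only the coordinates in
    \<open>E\<close>.\<close>
  have eq: "gibbs_fluctuation E \<gamma> a (\<lambda>e. g e \<omega>) (\<lambda>e. f e \<omega>) (\<mu> \<omega>) = \<Phi> (\<omega>, X \<omega>)" for \<omega>
  proof -
    have "field_Y E (\<lambda>e. g e \<omega>) (\<lambda>e. f e \<omega>) = field_Y E (X \<omega>) (\<lambda>e. f e \<omega>)"
      "field_W E a (\<lambda>e. g e \<omega>) (\<lambda>e. f e \<omega>) = field_W E a (X \<omega>) (\<lambda>e. f e \<omega>)"
      by (auto simp: field_Y_def field_W_def X_def fun_eq_iff)
    then show ?thesis by (simp add: \<Phi>_def gibbs_fluctuation_def)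
  qed
  interpret D: prob_space ?D by (rule prob_space_distr[OF id])
  interpret G: prob_space ?G by (intro prob_space_PiM prob_space_std_gaussian)
  interpret DG: pair_sigma_finite ?D ?G ..
  have int: "integrable M (\<lambda>\<omega>. \<Phi> (\<omega>, X \<omega>))"
  proof (rule Bochner_Integration.integrable_bound)
    have "integrable (distr M (\<Pi>\<^sub>M e\<in>E. borel) X) (\<lambda>x. K * (1 + (\<Sum>e\<in>E. (x e)\<^sup>2)))"
      unfolding X_distr
      by (intro integrable_mult_right Bochner_Integration.integrable_add G.integrable_const
        Bochner_Integration.integrable_sum integrable_PiM_gaussian_power)
    then show "integrable M (\<lambda>\<omega>. K * (1 + (\<Sum>e\<in>E. (X \<omega> e)\<^sup>2)))"
      by (rule integrable_distr[OF X_rv])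
    show "(\<lambda>\<omega>. \<Phi> (\<omega>, X \<omega>)) \<in> borel_measurable M"
      by (rule measurable_compose[OF XG \<Phi>_meas])
    show "AE \<omega> in M. norm (\<Phi> (\<omega>, X \<omega>)) \<le> norm (K * (1 + (\<Sum>e\<in>E. (X \<omega> e)\<^sup>2)))"
    proof (rule AE_I2)
      fix \<omega> assume "\<omega> \<in> space M"
      from gibbs_system.gibbs_fluctuation_bound[OF gibbs[OF this]]
      show "norm (\<Phi> (\<omega>, X \<omega>)) \<le> norm (K * (1 + (\<Sum>e\<in>E. (X \<omega> e)\<^sup>2)))"
        unfolding \<Phi>_def K_def by (auto intro: order_trans[OF _ abs_ge_self])
    qed
  qed
  have int_DG: "integrable (?D \<Otimes>\<^sub>M ?G) \<Phi>"
    unfolding joint[symmetric] using int by (simp add: integrable_distr_eq[OF XG \<Phi>_meas])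
  \<comment> \<open>The expectation moves to the product law, where the Gaussian vector is
    integrated first; the bound for frozen disorder then holds for each realization.\<close>
  have "expectation (\<lambda>\<omega>. \<Phi> (\<omega>, X \<omega>)) = (\<integral>p. \<Phi> p \<partial>(?D \<Otimes>\<^sub>M ?G))"
    unfolding joint[symmetric] by (rule integral_distr[OF XG \<Phi>_meas, symmetric])
  also have "\<dots> = (\<integral>\<omega>. (\<integral>x. \<Phi> (\<omega>, x) \<partial>?G) \<partial>?D)"
    by (rule DG.integral_fst'[OF int_DG, symmetric])
  also have "\<dots> \<le> B"
  proof (rule D.integral_le_const[OF DG.integrable_fst'[OF int_DG]], rule AE_I2)
    fix \<omega> assume "\<omega> \<in> space ?D"
    then have "\<omega> \<in> space M" using sp by simp
    from gibbs_system.integral_gibbs_fluctuation_le[OF gibbs[OF this]]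
    show "(\<integral>x. \<Phi> (\<omega>, x) \<partial>?G) \<le> B"
      by (simp add: \<Phi>_def B_def)
  qed
  finally show ?thesis
    using int unfolding eq B_def by simp
qed

end
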